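(* Let $k_1,k_2\ge0$ be integers with $(k_1,k_2)\ne(0,0)$, $k=k_1+k_2$, $\bar p\in(0,1)$, $\bar q=1-\bar p$ and $a(\bar p)=\bar q^{k_1}\bar p^{k_2}$. Let $\acute T=\hat T_1+\dots+\hat T_n$ where $\hat T_1,\dots,\hat T_n$ are i.i.d. $\mathbb{Z}_+$-valued with probability generating function $\frac{a(\bar p)}{1-z+a(\bar p)z^k}$. For $m\ge0$ let $b_{m,\bar p}=\sum_{l=0}^{\lfloor m/k\rfloor}(-1)^l\binom{m-l(k-1)}{l}a(\bar p)^l$. Assume $1-2ka(\bar p)+ka(\bar p)^2>0$, and let $$p=\frac{(1-ka(\bar p))a(\bar p)}{1-(2k-1)a(\bar p)},\qquad \alpha=\frac{n(1-ka(\bar p))^2}{1-2ka(\bar p)+ka(\bar p)^2},$$ $q=1-p$, and $Z\sim\mathrm{NB}(\alpha,p)$. Then $$d_{TV}(\acute T,Z)\le\frac{n}{\alpha q}\sqrt{\frac2\pi}\Bigl(\frac14+n\Bigl(1-\frac{a(\bar p)}{2}(1+a(\bar p))\Bigr)\Bigr)^{-1/2}\Bigl[\sum_{l=1}^\infty\frac{l(l-1)}{2}\bigl|b_{l,\bar p}-q\,b_{l-1,\bar p}\bigr|+\frac{k(k-1)(k-2)}{2}a(\bar p)+k\,a(\bar p)\sum_{l=k}^\infty\frac{l(l-1)}{2}\bigl|b_{l-k+1,\bar p}-q\,b_{l-k,\bar p}\bigr|\Bigr].$$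
   Context: Interpretation: in independent Bernoulli trials with success probability $\bar p$, a $(k_1,k_2)$-event is $k_1$ consecutive failures followed by $k_2$ consecutive successes; $\hat T_j$ is the number of trials between the $(j-1)$th and $j$th occurrence. $\mathrm{NB}(\alpha,p)$: $\mathbf{P}(Z=m)=\binom{\alpha+m-1}{m}p^\alpha q^m$, $m\ge0$. $d_{TV}(Y,X)=\frac12\sum_{m\ge0}|\mathbf{P}(Y=m)-\mathbf{P}(X=m)|$. The parameters match the mean $n(1-ka(\bar p))/a(\bar p)$ and variance $n(1-(2k-1)a(\bar p))/a(\bar p)^2$ of $\acute T$. *)

theory Defs
  imports "HOL-Probability.Probability_Mass_Function"
begin

definition run_a :: "nat \<Rightarrow> nat \<Rightarrow> real \<Rightarrow> real" where
  "run_a k1 k2 pb = (1 - pb) ^ k1 * pb ^ k2"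

definition bcoef :: "nat \<Rightarrow> real \<Rightarrow> nat \<Rightarrow> real" where
  "bcoef k a m = (\<Sum>l = 0..m div k. (-1) ^ l * real ((m - l * (k - 1)) choose l) * a ^ l)"

fun iid_sum_pmf :: "nat \<Rightarrow> nat pmf \<Rightarrow> nat pmf" where
  "iid_sum_pmf 0 D = return_pmf 0"
| "iid_sum_pmf (Suc n) D = bind_pmf D (\<lambda>x. map_pmf (\<lambda>y. x + y) (iid_sum_pmf n D))"

definition nb_prob :: "real \<Rightarrow> real \<Rightarrow> nat \<Rightarrow> real" where
  "nb_prob \<alpha> p m = ((\<alpha> + real m - 1) gchoose m) * p powr \<alpha> * (1 - p) ^ m"

definition dTV :: "(nat \<Rightarrow> real) \<Rightarrow> (nat \<Rightarrow> real) \<Rightarrow> real" where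
  "dTV f g = (1/2) * (\<Sum>m. \<bar>f m - g m\<bar>)"

end

theory Submission
  imports Defs "HOL-Analysis.Analysis" "HOL-Real_Asymp.Real_Asymp"
begin

text \<open>
  Write \<open>b\<close> for the coefficients of \<open>1 / (1 - z + a z^k)\<close>, so that the waiting time has point
  probabilities \<open>a * b m\<close>, and \<open>U\<close> for the generating function of the sum. The logarithmic derivative
  of \<open>U\<close> gives a Stein identity: the negative binomial Stein operator, averaged over the sum, is
  summation of \<open>g (m + 1)\<close> against the coefficients of \<open>U * E\<close> for an explicit power series \<open>E\<close>.
  Matching mean and variance means that \<open>E\<close> has a double zero at \<open>1\<close>, say \<open>E = (1 - z)^2 * H\<close>, so
  one summation by parts bounds the distance by the Stein factor \<open>1 / (\<alpha> q)\<close> times the coefficient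
  norms of \<open>(1 - z) * U\<close> and of \<open>H\<close>; the latter is at most the sum of \<open>l (l - 1) / 2 * \<bar>E l\<bar>\<close>.

  The norm of \<open>(1 - z) * U\<close> is twice the largest point probability, because \<open>b\<close> is log-concave and
  convolution with a log-concave sequence preserves unimodality. Nonnegativity of \<open>b\<close> forces \<open>a\<close> to
  be small (\<open>a \<le> 1/4\<close> for \<open>k = 2\<close>, \<open>k a \<le> 4/9\<close> for \<open>k \<ge> 3\<close>), and with this the Fourier inversion
  formula shows that the square of the largest point probability is at most
  \<open>1 / (2 \<pi> (n + 1/4))\<close>. For \<open>k = 1\<close> both sides vanish.
\<close>

section \<open>The generating function of the waiting time\<close>

text \<open>The waiting time is given by an identity of functions near 0; this turns it into one of
  formal series. Dividing out the lowest power leaves a series with nonzero constant term that is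
  continuous at 0 and vanishes on a punctured neighbourhood.\<close>

lemma fps_eq_0_if_eval_eq_0:
  fixes f :: "real fps"
  assumes rad: "fps_conv_radius f > 0"
    and r: "r > 0" and zero: "\<And>z. \<bar>z\<bar> < r \<Longrightarrow> eval_fps f z = 0"
  shows "f = 0"
proof (rule ccontr)
  assume "f \<noteq> 0"
  define g where "g = fps_shift (subdegree f) f"
  have g0: "fps_nth g 0 \<noteq> 0"
    using \<open>f \<noteq> 0\<close> by (simp add: g_def)
  have radg: "fps_conv_radius g > 0"
    using rad by (simp add: g_def)
  have cont: "isCont (eval_fps g) 0"
    using radg by (intro continuous_eval_fps) (simp_all add: zero_ereal_def)
  have "eventually (\<lambda>z. z \<in> eball 0 (fps_conv_radius f) \<inter> ball 0 r) (nhds 0)"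
    using rad r by (intro eventually_nhds_in_open) (auto simp: zero_ereal_def)
  hence "eventually (\<lambda>z. eval_fps g z = 0) (at 0)"
    unfolding eventually_at_filter
  proof eventually_elim
    case (elim z)
    thus ?case
      using zero[of z] eval_fps_shift[of "subdegree f" f z] by (auto simp: g_def)
  qed
  hence "(eval_fps g \<longlongrightarrow> 0) (at 0)"
    by (rule tendsto_eventually)
  moreover have "(eval_fps g \<longlongrightarrow> eval_fps g 0) (at 0)"
    using cont by (simp add: isCont_def)
  ultimately have "eval_fps g 0 = 0"
    using LIM_unique by blast
  with g0 show False
    by (simp add: eval_fps_at_0)
qed

text \<open>The ring stays generic because the denominator is used over the reals and, for
  characteristic functions, over the complex numbers.\<close>

definition run_den :: "nat \<Rightarrow> 'a \<Rightarrow> 'a :: comm_ring_1 fps" where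
  "run_den k a = 1 - fps_X + fps_const a * fps_X ^ k"

definition run_fps :: "nat \<Rightarrow> real \<Rightarrow> real fps" where
  "run_fps k a = Abs_fps (bcoef k a)"

lemma bcoef_0 [simp]: "bcoef k a 0 = 1"
  by (simp add: bcoef_def)

text \<open>Beyond \<open>m div k\<close> the truncated subtraction leaves an upper index below
  \<open>l\<close>, so the binomial is 0. A common cutoff \<open>N\<close> lets sums for different
  \<open>m\<close> be compared term by term.\<close>

lemma bcoef_conv_sum_le:
  assumes "k \<ge> 1" "m \<le> N"
  shows "bcoef k a m = (\<Sum>l\<le>N. (-1) ^ l * real ((m - l * (k - 1)) choose l) * a ^ l)"
  unfolding bcoef_def
proof (rule sum.mono_neutral_left)
  show "{0..m div k} \<subseteq> {..N}"
    using order_trans[OF div_le_dividend assms(2)] by auto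
  show "\<forall>i\<in>{..N} - {0..m div k}. (-1) ^ i * real (m - i * (k - 1) choose i) * a ^ i = 0"
  proof
    fix l assume "l \<in> {..N} - {0..m div k}"
    hence "m div k < l" by auto
    hence "m < l * k"
      using assms(1) by (simp add: div_less_iff_less_mult)
    hence "m - l * (k - 1) < l"
      using \<open>m div k < l\<close> assms(1) by (cases k) (auto simp: algebra_simps)
    thus "(-1) ^ l * real (m - l * (k - 1) choose l) * a ^ l = 0"
      by (simp add: binomial_eq_0)
  qed
qed simp

text \<open>The coefficient form of (1 - z + a z^k) B(z) = 1; it follows termwise from Pascal's
  rule.\<close>

lemma bcoef_Suc:
  assumes "k \<ge> 1"
  shows "bcoef k a (Suc m) = bcoef k a m - (if k \<le> Suc m then a * bcoef k a (Suc m - k) else 0)"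
proof -
  let ?c = "\<lambda>m l. (-1) ^ l * real ((m - l * (k - 1)) choose l) * a ^ l"
  have pascal: "?c (Suc m) (Suc l) =
      ?c m (Suc l) - (if k \<le> Suc m then a * ?c (Suc m - k) l else 0)" for l
  proof (cases "Suc l * (k - 1) \<le> m")
    case True
    hence "k \<le> Suc m"
      by auto
    have 1: "Suc m - Suc l * (k - 1) = Suc (m - Suc l * (k - 1))"
      using True by simp
    have 2: "m - Suc l * (k - 1) = Suc m - k - l * (k - 1)"
      using assms by (cases k) auto
    have "real (Suc m - Suc l * (k - 1) choose Suc l) =
        real (Suc m - k - l * (k - 1) choose l) + real (m - Suc l * (k - 1) choose Suc l)"
      unfolding 1 binomial_Suc_Suc by (simp only: 2 of_nat_add)
    thus ?thesis
      using \<open>k \<le> Suc m\<close> by (simp add: algebra_simps)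
  next
    case False
    \<comment> \<open>All three upper indices are truncated to 0 here. Only
      \<open>0 choose 0\<close> could survive, and it would need \<open>l = 0\<close>, which
      \<open>k \<le> Suc m\<close> rules out.\<close>
    have z1: "Suc m - Suc l * (k - 1) = 0"
      using False by simp
    have z2: "m - Suc l * (k - 1) = 0"
      using False by simp
    have "Suc m - k - l * (k - 1) = 0"
      using False assms by (cases k) auto
    moreover have "l > 0" if "k \<le> Suc m"
      using that False by (intro Nat.gr0I) auto
    ultimately show ?thesis
      unfolding z1 z2 by (auto simp: binomial_eq_0)
  qed
  have "bcoef k a (Suc m) = (\<Sum>l\<le>Suc m. ?c (Suc m) l)"
    by (rule bcoef_conv_sum_le) (use assms in auto)
  also have "\<dots> = 1 + (\<Sum>l\<le>m. ?c (Suc m) (Suc l))"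
    by (subst sum.atMost_Suc_shift) simp
  also have "\<dots> = (1 + (\<Sum>l\<le>m. ?c m (Suc l))) -
      (if k \<le> Suc m then a * (\<Sum>l\<le>m. ?c (Suc m - k) l) else 0)"
    unfolding pascal by (simp add: sum_subtractf sum_distrib_left)
  also have "1 + (\<Sum>l\<le>m. ?c m (Suc l)) = (\<Sum>l\<le>Suc m. ?c m l)"
    by (subst sum.atMost_Suc_shift) simp
  also have "\<dots> = bcoef k a m"
    by (rule bcoef_conv_sum_le [symmetric]) (use assms in auto)
  also have "(if k \<le> Suc m then a * (\<Sum>l\<le>m. ?c (Suc m - k) l) else 0) =
      (if k \<le> Suc m then a * bcoef k a (Suc m - k) else 0)"
    using bcoef_conv_sum_le[OF assms, of "Suc m - k" m a] assms by auto
  finally show ?thesis .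
qed

lemma fps_nth_run_den_mult:
  "fps_nth (run_den k a * f) m =
     fps_nth f m - (if m = 0 then 0 else fps_nth f (m - 1)) +
     (if k \<le> m then a * fps_nth f (m - k) else 0)"
proof -
  have "run_den k a * f = f - fps_X * f + fps_const a * (fps_X ^ k * f)"
    by (simp add: run_den_def algebra_simps)
  thus ?thesis
    by (simp add: fps_X_power_mult_nth)
qed

lemma run_den_mult_run_fps: "k \<ge> 1 \<Longrightarrow> run_den k a * run_fps k a = 1"
proof (rule fps_ext)
  fix m assume "k \<ge> 1"
  thus "fps_nth (run_den k a * run_fps k a) m = fps_nth 1 m"
    unfolding fps_nth_run_den_mult by (cases m) (auto simp: run_fps_def bcoef_Suc)
qed

lemma fps_conv_radius_run_den [simp]:
  fixes a :: "'a :: {banach, real_normed_field}"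
  shows "fps_conv_radius (run_den k a) = \<infinity>"
proof -
  have "run_den k a = fps_of_poly ([:1, -1:] + Polynomial.monom a k)"
    by (simp add: run_den_def fps_of_poly_simps fps_of_poly_monom fps_of_poly_pCons)
  thus ?thesis by (simp only: fps_conv_radius_fps_of_poly)
qed

lemma eval_fps_run_den [simp]:
  fixes a :: "'a :: {banach, real_normed_field}"
  shows "eval_fps (run_den k a) z = 1 - z + a * z ^ k"
proof -
  have "run_den k a = fps_of_poly ([:1, -1:] + Polynomial.monom a k)"
    by (simp add: run_den_def fps_of_poly_simps fps_of_poly_monom fps_of_poly_pCons)
  thus ?thesis by (simp add: poly_monom)
qed

lemma fps_pmf_eq_run_fps:
  fixes D :: "nat pmf"
  assumes k: "k \<ge> 1" and a: "0 < a" "a < 1"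
    and pgf: "\<And>z::real. \<bar>z\<bar> < 1 \<Longrightarrow> (\<Sum>m. pmf D m * z ^ m) = a / (1 - z + a * z ^ k)"
  shows "Abs_fps (pmf D) = fps_const a * run_fps k a"
proof -
  let ?P = "Abs_fps (pmf D)"
  have rad: "fps_conv_radius ?P \<ge> 1"
    unfolding fps_conv_radius_def
  proof (rule conv_radius_geI_ex')
    fix r :: real assume r: "r > 0" "ereal r < 1"
    have "summable (\<lambda>n. r ^ n)"
      using r by (intro summable_geometric) auto
    thus "summable (\<lambda>n. fps_nth ?P n * of_real r ^ n)"
      by (rule summable_comparison_test'[where N = 0])
        (use r in \<open>auto simp: abs_mult intro!: mult_left_le_one_le pmf_le_1\<close>)
  qed
  define f where "f = run_den k a * ?P - fps_const a"
  have radf: "fps_conv_radius f \<ge> 1"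
    unfolding f_def
    by (rule order_trans[OF _ fps_conv_radius_diff], simp,
        rule order_trans[OF _ fps_conv_radius_mult], simp add: rad)
  have "f = 0"
  proof (rule fps_eq_0_if_eval_eq_0)
    show "fps_conv_radius f > 0"
      using radf by (rule less_le_trans[rotated]) simp
    \<comment> \<open>On this disc 1 - z exceeds 1/2 while a z^k stays below 1/2 in absolute value,
      so the denominator of the generating function is positive and can be cleared.\<close>
    show "(1/2 :: real) > 0" by simp
    fix z :: real assume z: "\<bar>z\<bar> < 1/2"
    have lt: "ereal (norm z) < fps_conv_radius ?P"
      using z by (intro less_le_trans[OF _ rad]) auto
    have "ereal (norm z) < fps_conv_radius (run_den k a * ?P)"
      by (rule less_le_trans[OF _ fps_conv_radius_mult]) (use lt in auto)
    hence "eval_fps f z = (1 - z + a * z ^ k) * eval_fps ?P z - a"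
      using lt unfolding f_def by (simp add: eval_fps_diff eval_fps_mult)
    moreover have "eval_fps ?P z = a / (1 - z + a * z ^ k)"
      using pgf[of z] z by (simp add: eval_fps_def)
    moreover have "1 - z + a * z ^ k > 0"
    proof -
      have "\<bar>a * z ^ k\<bar> \<le> 1 * \<bar>z\<bar> ^ 1"
        unfolding abs_mult power_abs
        using a z k by (intro mult_mono power_decreasing) auto
      hence "\<bar>a * z ^ k\<bar> < 1/2" using z by simp
      thus ?thesis using z by linarith
    qed
    ultimately show "eval_fps f z = 0"
      by simp
  qed
  hence "run_den k a * ?P = fps_const a"
    by (simp add: f_def)
  hence "run_fps k a * run_den k a * ?P = run_fps k a * fps_const a"
    by (simp add: mult.assoc)
  thus ?thesis
    using run_den_mult_run_fps[OF k, of a] by (simp add: mult_ac)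
qed

section \<open>The law of the i.i.d. sum as a power of a generating function\<close>

lemma pmf_add_conv:
  fixes D Q :: "nat pmf"
  shows "pmf (bind_pmf D (\<lambda>x. map_pmf (\<lambda>y. x + y) Q)) m = (\<Sum>i\<le>m. pmf D i * pmf Q (m - i))"
proof -
  have "pmf (map_pmf (\<lambda>y. x + y) Q) m = (if x \<le> m then pmf Q (m - x) else 0)" for x
  proof (cases "x \<le> m")
    case True
    have "pmf (map_pmf (\<lambda>y. x + y) Q) (x + (m - x)) = pmf Q (m - x)"
      by (rule pmf_map_inj') auto
    thus ?thesis using True by simp
  next
    case False
    thus ?thesis by (auto simp: pmf_eq_0_set_pmf)
  qed
  hence "pmf (bind_pmf D (\<lambda>x. map_pmf (\<lambda>y. x + y) Q)) m =
      measure_pmf.expectation D (\<lambda>x. if x \<le> m then pmf Q (m - x) else 0)"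
    by (simp add: pmf_bind)
  also have "\<dots> = (\<Sum>i\<le>m. (if i \<le> m then pmf Q (m - i) else 0) * pmf D i)"
    by (subst integral_measure_pmf[of "{..m}"]) (auto simp: mult.commute split: if_splits)
  also have "\<dots> = (\<Sum>i\<le>m. pmf D i * pmf Q (m - i))"
    by (intro sum.cong) auto
  finally show ?thesis .
qed

lemma fps_pmf_iid_sum: "Abs_fps (pmf (iid_sum_pmf n D)) = Abs_fps (pmf D) ^ n"
proof (induction n)
  case 0
  show ?case by (rule fps_ext) (auto simp: pmf_return indicator_def)
next
  case (Suc n)
  have "Abs_fps (pmf (iid_sum_pmf (Suc n) D)) = Abs_fps (pmf D) * Abs_fps (pmf (iid_sum_pmf n D))"
    by (rule fps_ext) (simp add: pmf_add_conv fps_mult_nth atLeast0AtMost)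
  thus ?case by (simp add: Suc.IH)
qed

section \<open>Log-concavity of the coefficients\<close>

lemma powr_ge_Bernoulli:
  fixes r y :: real
  assumes r: "r \<ge> 1" and y: "y \<ge> 0"
  shows "1 + r * y \<le> (1 + y) powr r"
proof -
  let ?f = "\<lambda>x::real. r * ln (1 + x) - ln (1 + r * x)"
  have "?f 0 \<le> ?f y"
  proof (rule DERIV_nonneg_imp_nondecreasing[OF y])
    fix x :: real assume x: "0 \<le> x" "x \<le> y"
    have pos: "1 + r * x > 0" "1 + x > 0"
      using x r by (auto intro: add_pos_nonneg)
    have "(?f has_real_derivative (r / (1 + x) - r / (1 + r * x))) (at x)"
      using pos by (auto intro!: derivative_eq_intros)
    moreover have "1 * x \<le> r * x"
      using r x by (intro mult_right_mono) auto
    hence "r / (1 + x) - r / (1 + r * x) \<ge> 0"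
      using r x pos by (auto intro!: divide_left_mono)
    ultimately show "\<exists>D. (?f has_real_derivative D) (at x) \<and> 0 \<le> D"
      by blast
  qed
  hence "ln (1 + r * y) \<le> ln ((1 + y) powr r)"
    using y by (simp add: ln_powr)
  thus ?thesis
    using r y by (subst (asm) ln_le_cancel_iff) (auto intro: add_pos_nonneg)
qed

text \<open>Trades the exponent \<open>n\<close> for a fixed \<open>j\<close>. With
  \<open>j = 3\<close> the extremal problem for \<open>a\<close> reduces to the case k = 3; with
  \<open>j = 2\<close> or \<open>j = 3\<close> powers of characteristic functions reduce to
  integrands with explicit antiderivatives.\<close>

lemma power_ge_Bernoulli_power:
  fixes y :: real and n j :: nat
  assumes "j \<ge> 1" "j \<le> n" "y \<ge> 0"
  shows "(1 + real n / real j * y) ^ j \<le> (1 + y) ^ n"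
proof -
  have "(1 + real n / real j * y) ^ j \<le> ((1 + y) powr (real n / real j)) ^ j"
    using assms by (intro power_mono powr_ge_Bernoulli) auto
  also have "\<dots> = (1 + y) powr (real n / real j * real j)"
    using assms by (simp add: powr_powr flip: powr_realpow)
  also have "\<dots> = (1 + y) ^ n"
    using assms by (simp add: powr_realpow)
  finally show ?thesis .
qed

text \<open>In the application \<open>a * bcoef k a m\<close> is a point probability, which gives
  \<open>b_nonneg\<close>. This sign condition restricts \<open>a\<close>: monotonicity,
  log-concavity and the smallness of \<open>a\<close> are all drawn from it.\<close>

locale run_seq =
  fixes k :: nat and a :: real
  assumes k: "k \<ge> 1" and a_pos: "0 < a" and a_lt_1: "a < 1"
    and b_nonneg: "\<And>m. 0 \<le> bcoef k a m"
begin

abbreviation b :: "nat \<Rightarrow> real" where "b \<equiv> bcoef k a"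

abbreviation B :: "real fps" where "B \<equiv> run_fps k a"

lemma b_Suc_le: "b (Suc m) \<le> b m"
  using b_nonneg[of "Suc m - k"] a_pos k by (simp add: bcoef_Suc)

lemma b_antimono: "i \<le> j \<Longrightarrow> b j \<le> b i"
  using b_Suc_le by (rule lift_Suc_antimono_le)

lemma b_le_1: "b m \<le> 1"
  using b_antimono[of 0 m] by simp

lemma b_Suc_le_mult: "k \<le> Suc m \<Longrightarrow> b (Suc m) \<le> (1 - a) * b m"
  using b_antimono[of "Suc m - k" m] a_pos k
  by (simp add: bcoef_Suc algebra_simps)

text \<open>From index \<open>k\<close> on each step contracts by 1 - a; the prefactor absorbs the
  initial stretch, where only \<open>b m \<le> 1\<close> is used. The purpose is a radius of
  convergence beyond 1, so that moments and evaluations at 1 make sense.\<close>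

lemma b_le_geometric: "b m \<le> (1 / (1 - a) ^ k) * (1 - a) ^ m"
proof (induction m)
  case 0
  thus ?case using a_pos a_lt_1 by (simp add: power_le_one)
next
  case (Suc m)
  show ?case
  proof (cases "k \<le> Suc m")
    case True
    have "b (Suc m) \<le> (1 - a) * b m"
      using True by (rule b_Suc_le_mult)
    also have "\<dots> \<le> (1 - a) * ((1 / (1 - a) ^ k) * (1 - a) ^ m)"
      using Suc a_lt_1 by (intro mult_left_mono) auto
    finally show ?thesis by simp
  next
    case False
    have "(1 - a) ^ k \<le> (1 - a) ^ Suc m"
      using False a_pos a_lt_1 by (intro power_decreasing) auto
    hence "1 \<le> (1 / (1 - a) ^ k) * (1 - a) ^ Suc m"
      using a_lt_1 by simp
    thus ?thesis using b_le_1[of "Suc m"] by linarith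
  qed
qed

lemma fps_conv_radius_B: "fps_conv_radius B > 1"
proof -
  have "fps_conv_radius B \<ge> ereal (1 / (1 - a))"
    unfolding fps_conv_radius_def
  proof (rule conv_radius_geI_ex')
    fix r :: real assume r: "0 < r" "ereal r < ereal (1 / (1 - a))"
    have "(1 - a) * r < 1"
      using r a_lt_1 by (simp add: field_simps)
    hence "summable (\<lambda>n. (1 / (1 - a) ^ k) * ((1 - a) * r) ^ n)"
      using r a_lt_1 by (intro summable_mult summable_geometric) (auto simp: abs_mult)
    thus "summable (\<lambda>n. fps_nth B n * of_real r ^ n)"
    proof (rule summable_comparison_test'[where N = 0])
      fix n
      have "norm (fps_nth B n * of_real r ^ n) = b n * r ^ n"
        using r b_nonneg[of n] by (simp add: run_fps_def abs_mult)
      also have "\<dots> \<le> (1 / (1 - a) ^ k) * (1 - a) ^ n * r ^ n"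
        using r by (intro mult_right_mono b_le_geometric) auto
      finally show "norm (fps_nth B n * of_real r ^ n) \<le> (1 / (1 - a) ^ k) * ((1 - a) * r) ^ n"
        by (simp add: power_mult_distrib)
    qed
  qed
  moreover have "ereal (1 / (1 - a)) > 1"
    using a_pos a_lt_1 by simp
  ultimately show ?thesis by (rule less_le_trans[rotated])
qed

text \<open>A zero value would persist by monotonicity, and then the recurrence at index m + k would
  force \<open>a * b m = 0\<close>. For k = 1 the next value is (1 - a) times the present
  one.\<close>

lemma b_pos: "b m > 0"
proof (induction m)
  case (Suc m)
  show ?case
  proof (rule ccontr)
    assume "\<not> b (Suc m) > 0"
    hence 0: "b (Suc m) = 0" using b_nonneg[of "Suc m"] by simp
    show False
    proof (cases "k = 1")
      case True
      thus ?thesis using 0 Suc a_lt_1 by (simp add: bcoef_Suc)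
    next
      case False
      have z: "b j = 0" if "j \<ge> Suc m" for j
        using b_antimono[OF that] b_nonneg[of j] 0 by simp
      have "b (Suc (m + k - 1)) = b (m + k - 1) - a * b m"
        using k by (subst bcoef_Suc) auto
      moreover have "Suc m \<le> m + k - 1" using False k by auto
      ultimately show False
        using z[of "Suc (m + k - 1)"] z[of "m + k - 1"] k Suc a_pos by simp
    qed
  qed
qed simp

text \<open>Equivalent to decreasing ratios of consecutive terms. Inserting the recurrence twice
  turns b(m+1)^2 - b(m+2) b(m) into \<open>a\<close> times b(m+2-k) b(m) - b(m+1) b(m+1-k), which is
  nonnegative by ratios compared earlier; hence the strong induction.\<close>

lemma b_log_concave: "i \<le> j \<Longrightarrow> b (Suc j) * b i \<le> b (Suc i) * b j"
proof -
  define r where "r m = b (Suc m) / b m" for m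
  have step: "r (Suc m) \<le> r m" for m
  proof (induction m rule: less_induct)
    case (less m)
    have mono: "r j \<le> r i" if "i \<le> j" "j \<le> m" for i j
      using that
    proof (induction j rule: dec_induct)
      case (step j)
      thus ?case using less.IH[of j] by simp
    qed simp
    have "b (Suc (Suc m)) * b m \<le> b (Suc m) * b (Suc m)"
    proof (cases "k \<le> Suc m")
      case True
      have "r m \<le> r (Suc m - k)"
        using k by (intro mono) auto
      hence *: "b (Suc m) * b (Suc m - k) \<le> b (Suc (Suc m - k)) * b m"
        unfolding r_def using b_pos[of m] b_pos[of "Suc m - k"] by (simp add: field_simps)
      have 1: "b (Suc (Suc m)) = b (Suc m) - a * b (Suc (Suc m - k))"
        using k True bcoef_Suc[of k a "Suc m"] by (simp add: Suc_diff_le)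
      have 2: "b (Suc m) = b m - a * b (Suc m - k)"
        using k True bcoef_Suc[of k a m] by simp
      have "b (Suc m) * b (Suc m) - b (Suc (Suc m)) * b m =
          (b m - a * b (Suc m - k)) * b (Suc m) - (b (Suc m) - a * b (Suc (Suc m - k))) * b m"
        by (subst 1, subst (1) 2) simp
      also have "\<dots> = a * (b (Suc (Suc m - k)) * b m - b (Suc m) * b (Suc m - k))"
        by (simp add: algebra_simps)
      also have "\<dots> \<ge> 0" using * a_pos by simp
      finally show ?thesis by simp
    next
      case False
      have "b (Suc m) = b m"
        using False k by (simp add: bcoef_Suc)
      thus ?thesis
        using b_Suc_le[of "Suc m"] b_nonneg[of m] by (auto intro: mult_right_mono)
    qed
    thus ?case
      unfolding r_def using b_pos[of m] b_pos[of "Suc m"] by (simp add: field_simps)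
  qed
  assume "i \<le> j"
  hence "r j \<le> r i"
    using step by (rule lift_Suc_antimono_le[rotated])
  thus ?thesis
    unfolding r_def using b_pos[of i] b_pos[of j] by (simp add: field_simps)
qed

text \<open>
  Here \<open>y\<close> is the limit of the decreasing ratios of consecutive coefficients, for which the
  recurrence gives \<open>y ^ k \<le> y ^ (k - 1) - a\<close>.
\<close>

lemma exists_root_bound:
  obtains y where "0 < y" "y < 1" "a \<le> y ^ (k - 1) * (1 - y)"
proof -
  define r where "r m = b (Suc m) / b m" for m
  have r_pos: "r m > 0" for m by (simp add: r_def b_pos)
  have r_mono: "r j \<le> r i" if "i \<le> j" for i j
    unfolding r_def using b_log_concave[OF that] b_pos[of i] b_pos[of j] by (simp add: field_simps)
  have "decseq r" using r_mono by (simp add: decseq_def)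
  then obtain y where y: "r \<longlonglongrightarrow> y" "\<And>i. y \<le> r i"
    using decseq_convergent[of r 0] r_pos less_imp_le by blast
  have y0: "y \<ge> 0"
    using LIMSEQ_le_const[OF y(1), of 0] r_pos less_imp_le by blast
  have b_le: "b (m + j) \<le> r m ^ j * b m" for m j
  proof (induction j)
    case (Suc j)
    have "b (Suc (m + j)) = r (m + j) * b (m + j)"
      using b_pos[of "m + j"] by (simp add: r_def)
    also have "\<dots> \<le> r m * (r m ^ j * b m)"
      using Suc r_pos[of m] b_nonneg[of "m + j"] by (intro mult_mono r_mono) auto
    finally show ?case by simp
  qed simp
  have ineq: "r (m + (k - 1)) * r m ^ (k - 1) \<le> r m ^ (k - 1) - a" for m
  proof -
    have "b (Suc (m + (k - 1))) = b (m + (k - 1)) - a * b m"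
      using k by (subst bcoef_Suc) auto
    hence "r (m + (k - 1)) = 1 - a * (b m / b (m + (k - 1)))"
      using b_pos[of "m + (k - 1)"] by (simp add: r_def field_simps)
    moreover have "b m / b (m + (k - 1)) \<ge> 1 / r m ^ (k - 1)"
      using b_le[of m "k - 1"] b_pos[of "m + (k - 1)"] r_pos[of m]
      by (simp add: field_simps)
    hence "a * (1 / r m ^ (k - 1)) \<le> a * (b m / b (m + (k - 1)))"
      using a_pos by (intro mult_left_mono) auto
    ultimately have "r (m + (k - 1)) \<le> 1 - a * (1 / r m ^ (k - 1))"
      by linarith
    hence "r (m + (k - 1)) * r m ^ (k - 1) \<le> (1 - a * (1 / r m ^ (k - 1))) * r m ^ (k - 1)"
      using r_pos[of m] by (intro mult_right_mono) auto
    also have "\<dots> = r m ^ (k - 1) - a"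
      using r_pos[of m] by (simp add: algebra_simps)
    finally show ?thesis .
  qed
  have "y * y ^ (k - 1) \<le> y ^ (k - 1) - a"
  proof (rule LIMSEQ_le)
    show "(\<lambda>m. r (m + (k - 1)) * r m ^ (k - 1)) \<longlonglongrightarrow> y * y ^ (k - 1)"
      by (intro tendsto_intros LIMSEQ_ignore_initial_segment y)
    show "(\<lambda>m. r m ^ (k - 1) - a) \<longlonglongrightarrow> y ^ (k - 1) - a"
      by (intro tendsto_intros y)
  qed (use ineq in blast)
  hence le: "a \<le> y ^ (k - 1) * (1 - y)"
    by (simp add: algebra_simps)
  hence pos: "0 < y ^ (k - 1) * (1 - y)" using a_pos by linarith
  have "y < 1"
    using pos y0 by (simp add: zero_less_mult_iff)
  show ?thesis
  proof (cases "y = 0")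
    \<comment> \<open>A zero limit is compatible with positivity only for k = 1, where 1 - a is a
      valid witness.\<close>
    case True
    hence "k = 1" using pos k by (cases "k = 1") (auto simp: power_0_left)
    thus ?thesis using that[of "1 - a"] a_pos a_lt_1 by simp
  next
    case False
    thus ?thesis using that[of y] y0 \<open>y < 1\<close> le by simp
  qed
qed

text \<open>The maximum of k y^(k-1) (1 - y) decreases in k and equals 4/9 at k = 3. Bernoulli with
  exponent 3 reduces to that case, where the maximiser y = 2/3 corresponds to t = 1/2; the cubic
  below is (1 + t)^3 minus its tangent line there.\<close>

lemma k_times_a_le: 
  assumes "k \<ge> 3"
  shows "real k * a \<le> 4 / 9"
proof -
  obtain y where y: "0 < y" "y < 1" "a \<le> y ^ (k - 1) * (1 - y)"
    by (rule exists_root_bound)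
  define t where "t = real k / 3 * (1 / y - 1)"
  have "t \<ge> 0" using y by (simp add: t_def)
  have "0 \<le> (t - 1/2)\<^sup>2 * (t + 4)"
    using \<open>t \<ge> 0\<close> by simp
  also have "(t - 1/2)\<^sup>2 * (t + 4) = (1 + t) ^ 3 - 27 / 4 * t"
    by (simp add: power2_eq_square power3_eq_cube field_simps)
  finally have "27 / 4 * t \<le> (1 + t) ^ 3"
    by simp
  also have "(1 + t) ^ 3 \<le> (1 + (1 / y - 1)) ^ k"
    using power_ge_Bernoulli_power[of 3 k "1 / y - 1"] assms y by (simp add: t_def)
  finally have "27 / 4 * t * y ^ k \<le> 1"
    using y by (simp add: power_divide field_simps)
  moreover have "27 / 4 * t * y ^ k = 9 / 4 * real k * (y ^ (k - 1) * (1 - y))"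
    using y k by (cases k) (simp_all add: t_def field_simps)
  ultimately have "real k * (y ^ (k - 1) * (1 - y)) \<le> 4 / 9"
    by linarith
  moreover have "real k * a \<le> real k * (y ^ (k - 1) * (1 - y))"
    using y by (intro mult_left_mono) auto
  ultimately show ?thesis by linarith
qed

lemma a_le_quarter:
  assumes "k \<ge> 2"
  shows "a \<le> 1 / 4"
proof (cases "k = 2")
  case True
  obtain y where y: "0 < y" "y < 1" "a \<le> y ^ (k - 1) * (1 - y)"
    by (rule exists_root_bound)
  have "0 \<le> (y - 1/2)\<^sup>2" by simp
  thus ?thesis using y True by (simp add: power2_eq_square algebra_simps)
next
  case False
  hence "3 * a \<le> real k * a"
    using assms a_pos by (intro mult_right_mono) auto
  thus ?thesis using k_times_a_le False assms by linarith
qed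

end

section \<open>Stein factors for the negative binomial distribution\<close>

locale neg_binomial =
  fixes \<alpha> p q :: real
  assumes \<alpha>_pos: "\<alpha> > 0" and p_pos: "0 < p" and p_lt_1: "p < 1" and q_def: "q = 1 - p"
begin

lemma q_pos: "q > 0" and q_lt_1: "q < 1"
  using p_pos p_lt_1 by (auto simp: q_def)

abbreviation \<pi> :: "nat \<Rightarrow> real" where "\<pi> \<equiv> nb_prob \<alpha> p"

lemma nb_prob_conv_pochhammer: "\<pi> m = pochhammer \<alpha> m / fact m * p powr \<alpha> * q ^ m"
  by (simp add: nb_prob_def gbinomial_pochhammer' q_def)

lemma nb_prob_pos: "\<pi> m > 0"
  using \<alpha>_pos p_pos q_pos by (simp add: nb_prob_conv_pochhammer pochhammer_pos)

lemma nb_prob_nonneg: "\<pi> m \<ge> 0"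
  using nb_prob_pos[of m] by simp

lemma nb_prob_Suc: "real (Suc m) * \<pi> (Suc m) = q * (\<alpha> + real m) * \<pi> m"
  by (simp add: nb_prob_conv_pochhammer pochhammer_Suc field_simps del: of_nat_Suc)

lemma nb_prob_sums_1: "\<pi> sums 1"
proof -
  have "(\<lambda>m. (-\<alpha> gchoose m) * (-q) ^ m) sums (1 + -q) powr -\<alpha>"
    using q_pos q_lt_1 by (intro gen_binomial_real) auto
  hence "(\<lambda>m. p powr \<alpha> * ((-\<alpha> gchoose m) * (-q) ^ m)) sums (p powr \<alpha> * (1 + -q) powr -\<alpha>)"
    by (rule sums_mult)
  moreover have "p powr \<alpha> * ((-\<alpha> gchoose m) * (-q) ^ m) = \<pi> m" for m
  proof -
    have "(-\<alpha> gchoose m) * (-q) ^ m = ((-1) ^ m * (-1) ^ m) * (\<alpha> + real m - 1 gchoose m) * q ^ m"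
      by (subst gbinomial_minus) (simp add: power_minus[of q] mult_ac)
    also have "(-1) ^ m * (-1) ^ m = (1 :: real)"
      by (simp flip: power_add)
    finally show ?thesis by (simp add: nb_prob_def q_def)
  qed
  moreover have "p powr \<alpha> * (1 + -q) powr -\<alpha> = 1"
    using p_pos by (simp add: q_def powr_minus)
  ultimately show ?thesis by simp
qed

definition head :: "nat \<Rightarrow> real" where "head m = (\<Sum>i<m. \<pi> i)"

definition tail :: "nat \<Rightarrow> real" where "tail m = (\<Sum>i. \<pi> (i + m))"

lemma summable_nb_prob: "summable \<pi>" and suminf_nb_prob: "suminf \<pi> = 1"
  using nb_prob_sums_1 by (simp_all add: sums_iff)

lemma head_plus_tail: "head m + tail m = 1"
  using suminf_split_initial_segment[OF summable_nb_prob, of m] suminf_nb_prob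
  by (simp add: head_def tail_def)

lemma head_nonneg: "head m \<ge> 0"
  unfolding head_def by (intro sum_nonneg) (rule nb_prob_nonneg)

lemma tail_nonneg: "tail m \<ge> 0"
  unfolding tail_def
  by (intro suminf_nonneg summable_ignore_initial_segment summable_nb_prob)
     (rule nb_prob_nonneg)

text \<open>This bound and \<open>tail_ratio\<close> fix the signs in the difference of the Stein
  solution: mass below or above m contributes nonpositively. The step rests on
  \<open>nb_prob_Suc\<close> and q < 1.\<close>

lemma head_ratio: "q * (\<alpha> + real m) * head m \<le> real m * head (Suc m)"
proof (induction m)
  case (Suc m)
  have "q * (\<alpha> + real (Suc m)) * head (Suc m) =
      q * (\<alpha> + real m) * head m + q * (\<alpha> + real m) * \<pi> m + q * head (Suc m)"
    by (simp add: head_def algebra_simps)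
  also have "\<dots> \<le> real m * head (Suc m) + real (Suc m) * \<pi> (Suc m) + 1 * head (Suc m)"
  proof -
    have "q * head (Suc m) \<le> 1 * head (Suc m)"
      using q_lt_1 by (intro mult_right_mono head_nonneg) auto
    thus ?thesis using Suc nb_prob_Suc[of m] by linarith
  qed
  also have "\<dots> = real (Suc m) * head (Suc (Suc m))"
    by (simp add: head_def algebra_simps)
  finally show ?case .
qed (simp add: head_def)

lemma tail_ratio: "real m * tail (Suc m) \<le> q * (\<alpha> + real m) * tail m"
proof -
  have le: "real m * \<pi> (i + Suc m) \<le> q * (\<alpha> + real m) * \<pi> (i + m)" for i
  proof -
    let ?j = "i + m"
    have "real m * (\<alpha> + real ?j) \<le> (\<alpha> + real m) * real (Suc ?j)"
      using \<alpha>_pos by (simp add: algebra_simps)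
    hence "real m * (\<alpha> + real ?j) * (q * \<pi> ?j) \<le> (\<alpha> + real m) * real (Suc ?j) * (q * \<pi> ?j)"
      using q_pos nb_prob_pos[of ?j] by (intro mult_right_mono) auto
    hence "real (Suc ?j) * (real m * \<pi> (Suc ?j)) \<le> real (Suc ?j) * (q * (\<alpha> + real m) * \<pi> ?j)"
      using nb_prob_Suc[of ?j] by (simp add: mult_ac del: of_nat_Suc)
    thus ?thesis
      by (subst (asm) mult_le_cancel_left_pos) auto
  qed
  have "(\<Sum>i. real m * \<pi> (i + Suc m)) \<le> (\<Sum>i. q * (\<alpha> + real m) * \<pi> (i + m))"
    by (intro suminf_le le summable_mult summable_ignore_initial_segment summable_nb_prob)
  thus ?thesis
    unfolding tail_def
    by (simp add: suminf_mult summable_ignore_initial_segment summable_nb_prob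
             del: add_Suc_right)
qed

text \<open>
  At \<open>m = 0\<close> the quotient is \<open>0\<close> because the denominator vanishes; the Stein equation ignores that
  value, but the difference bound is stated for \<open>m \<ge> 1\<close> only.
\<close>

definition stein_sol :: "(nat \<Rightarrow> real) \<Rightarrow> nat \<Rightarrow> real" where
  "stein_sol f m = ((\<Sum>i<m. f i * \<pi> i) - (\<Sum>i. f i * \<pi> i) * head m) / (real m * \<pi> m)"

lemma summable_mult_nb_prob:
  assumes "\<And>i. 0 \<le> f i" "\<And>i. f i \<le> 1"
  shows "summable (\<lambda>i. f i * \<pi> i)"
  by (rule summable_comparison_test'[OF summable_nb_prob, where N = 0])
     (use assms nb_prob_pos in \<open>auto simp: abs_mult less_imp_le intro!: mult_left_le_one_le\<close>)

lemma stein_equation: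
  "q * (\<alpha> + real m) * stein_sol f (Suc m) - real m * stein_sol f m = f m - (\<Sum>i. f i * \<pi> i)"
proof -
  let ?A = "\<Sum>i. f i * \<pi> i"
  let ?N = "\<lambda>m. (\<Sum>i<m. f i * \<pi> i) - ?A * head m"
  have pos: "\<pi> m > 0" "q * (\<alpha> + real m) > 0"
    using nb_prob_pos q_pos \<alpha>_pos by auto
  have cancel: "c * (N / (c * x)) = N / x" if "c > 0" for c N x :: real
    using that by simp
  have "q * (\<alpha> + real m) * stein_sol f (Suc m) = ?N (Suc m) / \<pi> m"
    unfolding stein_sol_def nb_prob_Suc by (rule cancel[OF pos(2)])
  moreover have "real m * stein_sol f m = ?N m / \<pi> m"
  proof (cases "m = 0")
    case False
    thus ?thesis unfolding stein_sol_def by (intro cancel) auto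
  qed (simp add: head_def)
  moreover have "?N (Suc m) - ?N m = (f m - ?A) * \<pi> m"
    by (simp add: head_def algebra_simps)
  ultimately have "q * (\<alpha> + real m) * stein_sol f (Suc m) - real m * stein_sol f m =
      (f m - ?A) * \<pi> m / \<pi> m"
    by (simp only: diff_divide_distrib [symmetric])
  thus ?thesis
    using pos by simp
qed

text \<open>Split the f-weighted mass into \<open>x\<close> below m, \<open>y\<close> at m and
  \<open>z\<close> above m. By the ratio bounds x and z enter with nonpositive coefficients, so only
  the atom at m can raise the difference, and \<open>head_plus_tail\<close> bounds its contribution
  by 1 / (q (\<alpha> + m)).\<close>

lemma stein_sol_diff_le:
  assumes f: "\<And>i. 0 \<le> f i" "\<And>i. f i \<le> 1" and m: "m \<ge> 1"
  shows "stein_sol f (Suc m) - stein_sol f m \<le> 1 / (\<alpha> * q)"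
proof -
  define A where "A = (\<Sum>i. f i * \<pi> i)"
  define x where "x = (\<Sum>i<m. f i * \<pi> i)"
  define y where "y = f m * \<pi> m"
  define z where "z = (\<Sum>i. f (i + Suc m) * \<pi> (i + Suc m))"
  define c where "c = q * (\<alpha> + real m)"
  have c: "c > 0" using q_pos \<alpha>_pos by (simp add: c_def)
  have m': "real m > 0" using m by simp
  have pm: "\<pi> m > 0" by (rule nb_prob_pos)
  have x0: "x \<ge> 0"
    unfolding x_def by (intro sum_nonneg mult_nonneg_nonneg f) (rule nb_prob_nonneg)
  have z0: "z \<ge> 0"
    unfolding z_def
    by (rule suminf_nonneg, subst summable_iff_shift, rule summable_mult_nb_prob[OF f])
       (intro mult_nonneg_nonneg f nb_prob_nonneg)
  have y: "y \<le> \<pi> m" "y \<ge> 0"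
    using f[of m] pm by (auto simp: y_def intro: mult_left_le_one_le)
  have A: "A = x + y + z"
    unfolding A_def x_def y_def z_def
    using suminf_split_initial_segment[OF summable_mult_nb_prob[of f, OF f], of "Suc m"] by simp
  have 1: "(x + y) - A * head (Suc m) = (x + y) * tail (Suc m) - z * head (Suc m)"
    using head_plus_tail[of "Suc m"] unfolding A by algebra
  have 2: "x - A * head m = x * tail m - (y + z) * head m"
    using head_plus_tail[of m] unfolding A by algebra
  have "(stein_sol f (Suc m) - stein_sol f m) * \<pi> m =
      ((x + y) - A * head (Suc m)) / c - (x - A * head m) / real m"
    using c m' pm unfolding stein_sol_def nb_prob_Suc c_def[symmetric]
    by (simp add: A_def x_def y_def field_simps)
  also have "\<dots> = x * (tail (Suc m) / c - tail m / real m) + z * (head m / real m - head (Suc m) / c)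
      + y * (tail (Suc m) / c + head m / real m)"
    unfolding 1 2 by (simp add: diff_divide_distrib add_divide_distrib algebra_simps)
  also have "\<dots> \<le> 0 + 0 + \<pi> m * (1 / c)"
  proof (intro add_mono)
    have "tail (Suc m) / c \<le> tail m / real m"
      using tail_ratio[of m] c m' by (simp add: c_def[symmetric] field_simps)
    thus "x * (tail (Suc m) / c - tail m / real m) \<le> 0"
      using x0 by (intro mult_nonneg_nonpos) auto
    have *: "head m / real m \<le> head (Suc m) / c"
      using head_ratio[of m] c m' by (simp add: c_def[symmetric] field_simps)
    thus "z * (head m / real m - head (Suc m) / c) \<le> 0"
      using z0 by (intro mult_nonneg_nonpos) auto
    have "tail (Suc m) / c + head m / real m \<le> tail (Suc m) / c + head (Suc m) / c"
      using * by simp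
    also have "\<dots> = 1 / c"
      using head_plus_tail[of "Suc m"] by (simp add: add_divide_distrib[symmetric] add.commute)
    finally show "y * (tail (Suc m) / c + head m / real m) \<le> \<pi> m * (1 / c)"
      using y c m' pm tail_nonneg head_nonneg by (intro mult_mono) auto
  qed
  finally have "(stein_sol f (Suc m) - stein_sol f m) * \<pi> m \<le> 1 / c * \<pi> m"
    by (simp only: add_0 mult.commute)
  hence "stein_sol f (Suc m) - stein_sol f m \<le> 1 / c"
    using pm by (simp only: mult_le_cancel_right_pos)
  also have "\<dots> \<le> 1 / (\<alpha> * q)"
    using q_pos \<alpha>_pos by (intro divide_left_mono) (auto simp: c_def algebra_simps intro!: mult_pos_pos add_pos_nonneg)
  finally show ?thesis .
qed

text \<open>Passing to 1 - f flips the sign of the solution, which turns the one-sided bound on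
  differences into a two-sided one.\<close>

lemma stein_sol_complement:
  assumes f: "\<And>i. 0 \<le> f i" "\<And>i. f i \<le> 1"
  shows "stein_sol (\<lambda>i. 1 - f i) m = - stein_sol f m"
proof -
  have "(\<Sum>i. (1 - f i) * \<pi> i) = 1 - (\<Sum>i. f i * \<pi> i)"
    using suminf_diff[OF summable_nb_prob summable_mult_nb_prob[OF f]] suminf_nb_prob
    by (simp add: algebra_simps)
  moreover have "(\<Sum>i<m. (1 - f i) * \<pi> i) = head m - (\<Sum>i<m. f i * \<pi> i)"
    by (simp add: head_def algebra_simps sum_subtractf)
  moreover have "(h - s) - (1 - A) * h = - (s - A * h)" for h s A :: real
    by algebra
  ultimately show ?thesis
    unfolding stein_sol_def minus_divide_left by (simp only:)
qed

lemma abs_stein_sol_diff_le: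
  assumes f: "\<And>i. 0 \<le> f i" "\<And>i. f i \<le> 1" and m: "m \<ge> 1"
  shows "\<bar>stein_sol f (Suc m) - stein_sol f m\<bar> \<le> 1 / (\<alpha> * q)"
  using stein_sol_diff_le[OF f m] stein_sol_diff_le[of "\<lambda>i. 1 - f i" m] f m
  by (auto simp: stein_sol_complement[OF f] abs_le_iff)

lemma abs_stein_sol_le:
  assumes f: "\<And>i. 0 \<le> f i" "\<And>i. f i \<le> 1"
  shows "\<bar>stein_sol f (Suc m)\<bar> \<le> \<bar>stein_sol f 1\<bar> + real m * (1 / (\<alpha> * q))"
proof (induction m)
  case (Suc m)
  thus ?case
    using abs_stein_sol_diff_le[of f "Suc m", OF f] by (simp add: add_divide_distrib)
qed simp

text \<open>The maximum over test functions is attained at the indicator of the set where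
  \<open>u\<close> exceeds the negative binomial probabilities.\<close>

lemma dTV_eq_suminf:
  assumes u: "\<And>m. 0 \<le> u m" "u sums 1"
  obtains f where "\<And>i. 0 \<le> f i" "\<And>i. f i \<le> 1"
    "(\<lambda>m. u m * (f m - (\<Sum>i. f i * \<pi> i))) sums dTV u \<pi>"
proof -
  define f where "f m = (if u m > \<pi> m then 1 else 0 :: real)" for m
  have f: "\<And>i. 0 \<le> f i" "\<And>i. f i \<le> 1" by (auto simp: f_def)
  let ?A = "\<Sum>i. f i * \<pi> i"
  have su: "summable (\<lambda>m. f m * u m)"
    by (rule summable_comparison_test'[OF sums_summable[OF u(2)], where N = 0])
       (use u(1) in \<open>auto simp: f_def\<close>)
  have sp: "summable (\<lambda>m. f m * \<pi> m)" by (rule summable_mult_nb_prob[OF f])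
  \<comment> \<open>The positive part is counted twice and the signed difference subtracted; the
    latter sums to 1 - 1 = 0.\<close>
  have eq: "\<bar>u m - \<pi> m\<bar> = 2 * (f m * u m - f m * \<pi> m) - (u m - \<pi> m)" for m
    by (auto simp: f_def)
  have "(\<lambda>m. \<bar>u m - \<pi> m\<bar>) sums (2 * ((\<Sum>m. f m * u m) - ?A) - (1 - 1))"
    unfolding eq by (intro sums_diff sums_mult summable_sums su sp u nb_prob_sums_1)
  hence "dTV u \<pi> = (\<Sum>m. f m * u m) - ?A"
    by (simp add: dTV_def sums_iff)
  moreover have "(\<lambda>m. f m * u m - ?A * u m) sums ((\<Sum>m. f m * u m) - ?A * 1)"
    by (intro sums_diff sums_mult summable_sums su u)
  moreover have "f m * u m - ?A * u m = u m * (f m - ?A)" for m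
    by (simp add: algebra_simps)
  ultimately have "(\<lambda>m. u m * (f m - ?A)) sums dTV u \<pi>"
    by (simp only: mult_1_right)
  with f show ?thesis by (rule that)
qed

text \<open>Averaging the Stein equation over \<open>u\<close> and collecting the factors of g(m +
  1) gives weights whose partial sums are \<open>V\<close>. Summation by parts moves the difference
  onto g, where the Stein factor applies.\<close>

lemma dTV_le_stein:
  assumes u: "\<And>m. 0 \<le> u m" "u sums 1"
    and u_lim: "(\<lambda>m. real m ^ 2 * u m) \<longlonglongrightarrow> 0"
    and V: "\<And>m. V m = (\<Sum>i\<le>m. q * (\<alpha> + real i) * u i - real (Suc i) * u (Suc i))"
    and V_lim: "(\<lambda>m. real m * V m) \<longlonglongrightarrow> 0"
    and V_sum: "summable (\<lambda>m. \<bar>V m\<bar>)"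
  shows "dTV u \<pi> \<le> 1 / (\<alpha> * q) * (\<Sum>m. \<bar>V m\<bar>)"
proof -
  obtain f where f: "\<And>i. 0 \<le> f i" "\<And>i. f i \<le> 1"
    and sums: "(\<lambda>m. u m * (f m - (\<Sum>i. f i * \<pi> i))) sums dTV u \<pi>"
    using dTV_eq_suminf[OF u] by blast
  define g where "g = stein_sol f"
  define d where "d = 1 / (\<alpha> * q)"
  have d: "d \<ge> 0" using \<alpha>_pos q_pos by (simp add: d_def)
  define C where "C = \<bar>g 1\<bar> + d"
  have g_le: "\<bar>g (Suc m)\<bar> \<le> C * real (Suc m)" for m
  proof -
    have "\<bar>g (Suc m)\<bar> \<le> \<bar>g 1\<bar> * 1 + d * real m"
      using abs_stein_sol_le[of f m, OF f] by (simp add: g_def d_def)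
    also have "\<dots> \<le> \<bar>g 1\<bar> * real (Suc m) + d * real (Suc m)"
      using d by (intro add_mono mult_left_mono) auto
    finally show ?thesis by (simp add: C_def algebra_simps)
  qed
  \<comment> \<open>Shifting the index in the term with m g(m) leaves the last summand; the first
    one is the boundary term of the summation by parts.\<close>
  have partial: "(\<Sum>m\<le>M. u m * (f m - (\<Sum>i. f i * \<pi> i))) =
      V M * g (Suc M) - (\<Sum>m<M. V m * (g (Suc (Suc m)) - g (Suc m)))
      + real (Suc M) * u (Suc M) * g (Suc M)" for M
  proof (induction M)
    case 0
    show ?case
      using stein_equation[of 0 f] by (simp add: V g_def algebra_simps flip: stein_equation)
  next
    case (Suc M)
    have "V (Suc M) = V M + (q * (\<alpha> + real (Suc M)) * u (Suc M) - real (Suc (Suc M)) * u (Suc (Suc M)))"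
      by (simp add: V)
    moreover have "f (Suc M) - (\<Sum>i. f i * \<pi> i) =
        q * (\<alpha> + real (Suc M)) * g (Suc (Suc M)) - real (Suc M) * g (Suc M)"
      by (simp add: g_def stein_equation del: of_nat_Suc)
    ultimately show ?case
      using Suc.IH unfolding sum.atMost_Suc sum.lessThan_Suc by algebra
  qed
  \<comment> \<open>\<open>e M\<close> dominates both boundary terms. Since g grows at most
    linearly, they vanish under the decay assumptions on \<open>V\<close> and
    \<open>u\<close>.\<close>
  define e where "e M = C * (real (Suc M) * \<bar>V M\<bar> + real (Suc M) ^ 2 * u (Suc M))" for M
  have bound: "(\<Sum>m\<le>M. u m * (f m - (\<Sum>i. f i * \<pi> i))) \<le> d * (\<Sum>m. \<bar>V m\<bar>) + e M" for M
  proof -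
    have "V M * g (Suc M) \<le> \<bar>V M\<bar> * (C * real (Suc M))"
      using mult_left_mono[OF g_le, of "\<bar>V M\<bar>" M] abs_ge_self[of "V M * g (Suc M)"]
      unfolding abs_mult by linarith
    moreover have "- (\<Sum>m<M. V m * (g (Suc (Suc m)) - g (Suc m))) \<le> d * (\<Sum>m. \<bar>V m\<bar>)"
    proof -
      have "- (\<Sum>m<M. V m * (g (Suc (Suc m)) - g (Suc m))) \<le> (\<Sum>m<M. \<bar>V m\<bar> * d)"
        unfolding sum_negf[symmetric]
      proof (rule sum_mono)
        fix m
        have "- (V m * (g (Suc (Suc m)) - g (Suc m))) \<le> \<bar>V m * (g (Suc (Suc m)) - g (Suc m))\<bar>"
          by (rule abs_ge_minus_self)
        also have "\<dots> \<le> \<bar>V m\<bar> * d"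
          unfolding abs_mult using abs_stein_sol_diff_le[of f "Suc m", OF f]
          by (intro mult_left_mono) (auto simp: g_def d_def)
        finally show "- (V m * (g (Suc (Suc m)) - g (Suc m))) \<le> \<bar>V m\<bar> * d" .
      qed
      also have "\<dots> = d * (\<Sum>m<M. \<bar>V m\<bar>)"
        by (simp add: sum_distrib_left mult.commute)
      also have "\<dots> \<le> d * (\<Sum>m. \<bar>V m\<bar>)"
        using d V_sum by (intro mult_left_mono sum_le_suminf) auto
      finally show ?thesis .
    qed
    moreover have "real (Suc M) * u (Suc M) * g (Suc M) \<le> real (Suc M) * u (Suc M) * (C * real (Suc M))"
      using g_le[of M] u(1)[of "Suc M"] by (intro mult_left_mono) auto
    moreover have "e M = \<bar>V M\<bar> * (C * real (Suc M)) + real (Suc M) * u (Suc M) * (C * real (Suc M))"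
      by (simp add: e_def power2_eq_square algebra_simps del: of_nat_Suc)
    ultimately show ?thesis
      unfolding partial by linarith
  qed
  have "e \<longlonglongrightarrow> C * (0 + 0)"
    unfolding e_def
  proof (intro tendsto_intros)
    have "V \<longlonglongrightarrow> 0"
      using summable_LIMSEQ_zero[OF V_sum] by (simp add: tendsto_rabs_zero_iff)
    hence "(\<lambda>m. \<bar>real m * V m\<bar> + \<bar>V m\<bar>) \<longlonglongrightarrow> 0 + 0"
      by (intro tendsto_add tendsto_rabs_zero V_lim)
    thus "(\<lambda>M. real (Suc M) * \<bar>V M\<bar>) \<longlonglongrightarrow> 0"
      by (simp add: abs_mult algebra_simps)
    show "(\<lambda>M. real (Suc M) ^ 2 * u (Suc M)) \<longlonglongrightarrow> 0"
      using LIMSEQ_Suc[OF u_lim] by simp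
  qed
  hence "(\<lambda>M. d * (\<Sum>m. \<bar>V m\<bar>) + e M) \<longlonglongrightarrow> d * (\<Sum>m. \<bar>V m\<bar>) + C * (0 + 0)"
    by (intro tendsto_intros)
  moreover have "(\<lambda>M. \<Sum>m\<le>M. u m * (f m - (\<Sum>i. f i * \<pi> i))) \<longlonglongrightarrow> dTV u \<pi>"
    using sums by (simp add: sums_def_le)
  ultimately have "dTV u \<pi> \<le> d * (\<Sum>m. \<bar>V m\<bar>) + C * (0 + 0)"
    using bound by (intro LIMSEQ_le) blast+
  thus ?thesis by (simp add: d_def)
qed

end

section \<open>Unimodality\<close>

text \<open>Applied to the coefficients of (1 - z) f, which are the successive differences of f,
  this expresses unimodality.\<close>

definition sign_change :: "(nat \<Rightarrow> real) \<Rightarrow> bool" where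
  "sign_change v \<longleftrightarrow> (\<forall>i j. i \<le> j \<longrightarrow> v i < 0 \<longrightarrow> v j \<le> 0)"

text \<open>
  With \<open>s\<close> the position of the sign change, log-concavity of \<open>g\<close> gives, term by term,
  \<open>g (m - s) * w (m + 1) \<le> g (m - s + 1) * w m\<close> for the coefficients \<open>w\<close> of the product.
\<close>

lemma sign_change_mult:
  fixes f g :: "real fps"
  assumes sc: "sign_change (fps_nth f)"
    and pos: "\<And>m. fps_nth g m > 0"
    and lc: "\<And>i j. i \<le> j \<Longrightarrow>
      fps_nth g (Suc j) * fps_nth g i \<le> fps_nth g (Suc i) * fps_nth g j"
  shows "sign_change (fps_nth (f * g))"
proof (cases "\<forall>i. fps_nth f i \<ge> 0")
  case True
  hence "fps_nth (f * g) m \<ge> 0" for m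
    unfolding fps_mult_nth by (intro sum_nonneg mult_nonneg_nonneg) (auto intro: less_imp_le pos)
  thus ?thesis by (auto simp: sign_change_def not_less [symmetric])
next
  case False
  define s where "s = (LEAST i. fps_nth f i < 0)"
  have s: "fps_nth f s < 0"
    using False unfolding s_def by (metis LeastI not_le)
  have below: "fps_nth f i \<ge> 0" if "i < s" for i
    using not_less_Least[OF that[unfolded s_def]] by simp
  have above: "fps_nth f i \<le> 0" if "i \<ge> s" for i
    using sc s that unfolding sign_change_def by blast
  let ?w = "fps_nth (f * g)"
  have w_below: "?w m \<ge> 0" if "m < s" for m
    unfolding fps_mult_nth
    using that by (intro sum_nonneg mult_nonneg_nonneg below less_imp_le[OF pos]) auto
  have step: "?w (Suc m) \<le> 0" if m: "m \<ge> s" and le: "?w m \<le> 0" for m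
  proof -
    have "fps_nth g (m - s) * ?w (Suc m) =
        (\<Sum>i=0..m. fps_nth f i * (fps_nth g (Suc (m - i)) * fps_nth g (m - s)))
        + fps_nth f (Suc m) * (fps_nth g 0 * fps_nth g (m - s))"
      by (simp add: fps_mult_nth sum_distrib_left Suc_diff_le algebra_simps)
    also have "fps_nth f (Suc m) * (fps_nth g 0 * fps_nth g (m - s)) \<le> 0"
      using above[of "Suc m"] m pos by (intro mult_nonpos_nonneg) (auto intro: less_imp_le)
    also have "(\<Sum>i=0..m. fps_nth f i * (fps_nth g (Suc (m - i)) * fps_nth g (m - s))) \<le>
        (\<Sum>i=0..m. fps_nth f i * (fps_nth g (Suc (m - s)) * fps_nth g (m - i)))"
    proof (rule sum_mono)
      fix i assume "i \<in> {0..m}"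
      show "fps_nth f i * (fps_nth g (Suc (m - i)) * fps_nth g (m - s)) \<le>
          fps_nth f i * (fps_nth g (Suc (m - s)) * fps_nth g (m - i))"
      \<comment> \<open>At i = s the sign of f and the order of m - i and m - s switch together, so
        log-concavity moves every term in the same direction.\<close>
      proof (cases "i < s")
        case True
        thus ?thesis using below[OF True] lc[of "m - s" "m - i"] by (intro mult_left_mono) auto
      next
        case False
        thus ?thesis using above[of i] lc[of "m - i" "m - s"]
          by (intro mult_left_mono_neg) (auto simp: mult.commute)
      qed
    qed
    also have "\<dots> = fps_nth g (Suc (m - s)) * ?w m"
      by (simp add: fps_mult_nth sum_distrib_left algebra_simps)
    finally have "fps_nth g (m - s) * ?w (Suc m) \<le> fps_nth g (Suc (m - s)) * ?w m"
      by simp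
    also have "\<dots> \<le> 0"
      using le pos[of "Suc (m - s)"] by (intro mult_nonneg_nonpos) auto
    finally show ?thesis
      using pos[of "m - s"] by (simp add: mult_le_0_iff)
  qed
  show ?thesis
    unfolding sign_change_def
  proof (intro allI impI)
    fix i j :: nat assume ij: "i \<le> j" "?w i < 0"
    have "i \<ge> s" using w_below[of i] ij by (meson not_le)
    from ij(1) show "?w j \<le> 0"
    proof (induction j rule: dec_induct)
      case base
      thus ?case using ij by simp
    next
      case (step j)
      thus ?case using \<open>i \<ge> s\<close> by (intro \<open>\<And>m. _ \<Longrightarrow> _ \<Longrightarrow> ?w (Suc m) \<le> 0\<close>) auto
    qed
  qed
qed

lemma fps_nth_one_minus_X_mult:
  fixes f :: "'a :: comm_ring_1 fps"
  shows "fps_nth ((1 - fps_X) * f) m = fps_nth f m - (if m = 0 then 0 else fps_nth f (m - 1))"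
  by (simp add: algebra_simps)

lemma sum_fps_nth_one_minus_X_mult:
  fixes f :: "'a :: comm_ring_1 fps"
  shows "(\<Sum>m<Suc N. fps_nth ((1 - fps_X) * f) m) = fps_nth f N"
proof (induction N)
  case (Suc N)
  have "(\<Sum>m<Suc (Suc N). fps_nth ((1 - fps_X) * f) m) =
      fps_nth f N + fps_nth ((1 - fps_X) * f) (Suc N)"
    unfolding sum.lessThan_Suc[of _ "Suc N"] Suc.IH ..
  thus ?case by (simp add: fps_nth_one_minus_X_mult)
qed (simp add: fps_nth_one_minus_X_mult)

text \<open>A sequence that rises to a peak and then falls has total variation equal to twice the
  peak minus the last value.\<close>

lemma sum_abs_one_minus_X_mult_le:
  fixes f :: "real fps"
  assumes sc: "sign_change (fps_nth ((1 - fps_X) * f))"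
    and nonneg: "\<And>m. 0 \<le> fps_nth f m" and le: "\<And>m. fps_nth f m \<le> M"
  shows "(\<Sum>m<N. \<bar>fps_nth ((1 - fps_X) * f) m\<bar>) \<le> 2 * M"
proof -
  let ?v = "fps_nth ((1 - fps_X) * f)"
  have M: "M \<ge> 0" using nonneg[of 0] le[of 0] by linarith
  have psum: "(\<Sum>m<j. ?v m) = (if j = 0 then 0 else fps_nth f (j - 1))" for j
    using sum_fps_nth_one_minus_X_mult[of f "j - 1"] by (cases j) simp_all
  have psum_bounds: "0 \<le> (\<Sum>m<j. ?v m)" "(\<Sum>m<j. ?v m) \<le> M" for j
    unfolding psum using nonneg le M by auto
  show ?thesis
  proof (cases "\<exists>i<N. ?v i < 0")
    case False
    hence "(\<Sum>m<N. \<bar>?v m\<bar>) = (\<Sum>m<N. ?v m)"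
      by (intro sum.cong refl abs_of_nonneg) (meson lessThan_iff not_less)
    thus ?thesis using psum_bounds(2)[of N] M by linarith
  next
    case True
    define s where "s = (LEAST i. ?v i < 0)"
    have s: "?v s < 0" using True unfolding s_def by (metis LeastI)
    have "s \<le> N" using True unfolding s_def by (metis Least_le less_imp_le le_trans)
    have below: "?v i \<ge> 0" if "i < s" for i
      using not_less_Least[OF that[unfolded s_def]] by simp
    have above: "?v i \<le> 0" if "i \<ge> s" for i
      using sc s that unfolding sign_change_def by blast
    have split: "sum h {..<N} = sum h {..<s} + sum h {s..<N}" for h :: "nat \<Rightarrow> real"
      using \<open>s \<le> N\<close> by (metis atLeast0LessThan sum.atLeastLessThan_concat zero_le)
    have "(\<Sum>m<s. \<bar>?v m\<bar>) = (\<Sum>m<s. ?v m)"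
      by (intro sum.cong) (use below in auto)
    moreover have "(\<Sum>m=s..<N. \<bar>?v m\<bar>) = - (\<Sum>m=s..<N. ?v m)"
      unfolding sum_negf[symmetric] by (intro sum.cong refl abs_of_nonpos above) auto
    ultimately have "(\<Sum>m<N. \<bar>?v m\<bar>) = 2 * (\<Sum>m<s. ?v m) - (\<Sum>m<N. ?v m)"
      using split[of "\<lambda>m. \<bar>?v m\<bar>"] split[of ?v] by linarith
    thus ?thesis
      using psum_bounds(2)[of s] psum_bounds(1)[of N] by linarith
  qed
qed

section \<open>Powers of the waiting time series and their unimodality\<close>

context run_seq
begin

definition P :: "real fps" where "P = fps_const a * B"

lemma fps_nth_P: "fps_nth P m = a * b m"
  by (simp add: P_def run_fps_def)

lemma run_den_mult_P: "run_den k a * P = fps_const a"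
  using run_den_mult_run_fps[OF k, of a] by (simp add: P_def mult_ac)

lemma fps_conv_radius_P: "fps_conv_radius P > 1"
  unfolding P_def
  by (rule less_le_trans[OF _ fps_conv_radius_mult]) (simp add: fps_conv_radius_B)

lemma fps_conv_radius_P_power: "fps_conv_radius (P ^ n) > 1"
  by (rule less_le_trans[OF fps_conv_radius_P fps_conv_radius_power])

lemma eval_P_1: "eval_fps P 1 = 1"
proof -
  have "eval_fps (run_den k a * P) 1 = (1 - 1 + a * 1 ^ k) * eval_fps P 1"
    using fps_conv_radius_P by (subst eval_fps_mult) (auto simp: one_ereal_def)
  thus ?thesis using a_pos by (simp add: run_den_mult_P)
qed

lemma P_power_nonneg: "fps_nth (P ^ n) m \<ge> 0"
proof (induction n arbitrary: m)
  case (Suc n)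
  thus ?case
    unfolding power_Suc fps_mult_nth
    by (intro sum_nonneg mult_nonneg_nonneg) (auto simp: fps_nth_P a_pos less_imp_le b_nonneg)
qed auto

lemma P_power_sums: "fps_nth (P ^ n) sums 1"
proof -
  have "(\<lambda>m. fps_nth (P ^ n) m * 1 ^ m) sums eval_fps (P ^ n) 1"
    using fps_conv_radius_P_power[of n] by (intro sums_eval_fps) (simp add: one_ereal_def)
  moreover have "eval_fps (P ^ n) 1 = 1"
    using fps_conv_radius_P eval_P_1 by (subst eval_fps_power) (auto simp: one_ereal_def)
  ultimately show ?thesis by simp
qed

text \<open>One factor has coefficients at most \<open>a\<close>, and convolution with a probability
  sequence preserves this. It serves the cases n \<le> 2 and k = 1.\<close>

lemma P_power_le_a:
  assumes "n \<ge> 1"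
  shows "fps_nth (P ^ n) m \<le> a"
proof -
  obtain n' where n: "n = Suc n'" using assms by (cases n) auto
  have "fps_nth (P ^ n) m = (\<Sum>i=0..m. fps_nth (P ^ n') i * fps_nth P (m - i))"
    unfolding n power_Suc2 fps_mult_nth ..
  also have "\<dots> \<le> (\<Sum>i=0..m. fps_nth (P ^ n') i * a)"
    using a_pos b_le_1 by (intro sum_mono mult_left_mono P_power_nonneg) (auto simp: fps_nth_P)
  also have "\<dots> = (\<Sum>i=0..m. fps_nth (P ^ n') i) * a"
    by (simp add: sum_distrib_right)
  also have "\<dots> \<le> 1 * a"
    using sum_le_suminf[of "fps_nth (P ^ n')" "{0..m}"] P_power_sums[of n'] P_power_nonneg a_pos
    by (intro mult_right_mono) (auto simp: sums_iff)
  finally show ?thesis by simp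
qed

lemma sign_change_P_power:
  assumes "n \<ge> 1"
  shows "sign_change (fps_nth ((1 - fps_X) * P ^ n))"
  using assms
proof (induction n rule: dec_induct)
  case base
  have "fps_nth ((1 - fps_X) * P) m \<le> 0" if "m > 0" for m
    using that b_antimono[of "m - 1" m] a_pos
    unfolding fps_nth_one_minus_X_mult by (simp add: fps_nth_P)
  moreover have "fps_nth ((1 - fps_X) * P) 0 \<ge> 0"
    unfolding fps_nth_one_minus_X_mult by (simp add: fps_nth_P a_pos less_imp_le)
  ultimately show ?case
    unfolding sign_change_def power_one_right by (metis bot_nat_0.not_eq_extremum le_zero_eq not_less)
next
  case (step n)
  have "sign_change (fps_nth ((1 - fps_X) * P ^ n * P))"
  proof (rule sign_change_mult[OF step.IH])
    fix i j :: nat assume "i \<le> j"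
    from b_log_concave[OF this] show "fps_nth P (Suc j) * fps_nth P i \<le> fps_nth P (Suc i) * fps_nth P j"
      using a_pos by (simp add: fps_nth_P mult_ac)
  qed (simp add: fps_nth_P a_pos b_pos)
  thus ?case by (simp add: mult_ac)
qed

end

section \<open>Fourier bound for the maximal probability\<close>

lemma cos_int_has_integral:
  fixes i m :: nat
  shows "((\<lambda>t. cos ((real i - real m) * t)) has_integral (if i = m then pi else 0)) {0..pi}"
proof (cases "i = m")
  case True
  thus ?thesis using has_integral_const_real[of "1::real" 0 pi] by simp
next
  case False
  define j where "j = real i - real m"
  have j: "j \<noteq> 0" using False by (simp add: j_def)
  have "((\<lambda>t. cos (j * t)) has_integral (sin (j * pi) / j - sin (j * 0) / j)) {0..pi}"
    using j by (intro fundamental_theorem_of_calculus)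
      (auto intro!: derivative_eq_intros simp: has_real_derivative_iff_has_vector_derivative[symmetric])
  moreover have "sin (j * pi) = 0"
    using sin_zero_iff_int2[of "j * pi"] by (auto simp: j_def intro!: exI[of _ "int i - int m"])
  ultimately show ?thesis using False by (simp add: j_def)
qed

text \<open>Fourier inversion for real coefficients, where half the period suffices. Truncating at
  \<open>N\<close> with the error \<open>e N\<close>, uniform in t, avoids interchanging sum and
  integral.\<close>

lemma coeff_le_fourier_integral:
  fixes u :: "nat \<Rightarrow> real"
  assumes sum: "summable (\<lambda>i. \<bar>u i\<bar>)"
    and h: "(h has_integral I) {0..pi}"
    and le: "\<And>t. 0 \<le> t \<Longrightarrow> t \<le> pi \<Longrightarrow> cmod (\<Sum>i. of_real (u i) * cis t ^ i) \<le> h t"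
  shows "u m \<le> I / pi"
proof -
  define e where "e N = (\<Sum>i. \<bar>u (i + N)\<bar>)" for N
  have bound: "pi * u m \<le> I + pi * e N" if N: "N > m" for N
  proof -
    let ?S = "\<lambda>t. \<Sum>i<N. u i * cos ((real i - real m) * t)"
    have "(?S has_integral (\<Sum>i<N. u i * (if i = m then pi else 0))) {0..pi}"
      by (intro has_integral_sum has_integral_mult_right cos_int_has_integral) auto
    moreover have "(\<Sum>i<N. u i * (if i = m then pi else 0)) = pi * u m"
      using N by (simp add: if_distrib[of "\<lambda>x. _ * x"] cong: if_cong)
    ultimately have int1: "(?S has_integral (pi * u m)) {0..pi}" by simp
    have int2: "((\<lambda>t. h t + e N) has_integral (I + pi * e N)) {0..pi}"
      using has_integral_add[OF h has_integral_const_real[of "e N" 0 pi]] by simp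
    show ?thesis
    proof (rule has_integral_le[OF int1 int2])
      fix t assume t: "t \<in> {0..pi}"
      have sc: "summable (\<lambda>i. cmod (of_real (u i) * cis t ^ i))"
        using sum by (simp add: norm_mult norm_power)
      let ?F = "\<lambda>i. of_real (u i) * cis t ^ i"
      have "?S t = Re (cis (- (real m * t)) * (\<Sum>i<N. ?F i))"
        by (simp add: sum_distrib_left cos_n_Re_cis_pow_n [symmetric] sin_n_Im_cis_pow_n [symmetric] cos_diff algebra_simps)
      also have "\<dots> \<le> cmod (cis (- (real m * t)) * (\<Sum>i<N. ?F i))"
        by (rule complex_Re_le_cmod)
      also have "\<dots> = cmod ((\<Sum>i. ?F i) - (\<Sum>i. ?F (i + N)))"
        using suminf_split_initial_segment[OF summable_norm_cancel[OF sc], of N]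
        by (simp add: norm_mult)
      also have "\<dots> \<le> cmod (\<Sum>i. ?F i) + cmod (\<Sum>i. ?F (i + N))"
        by (rule norm_triangle_ineq4)
      also have "cmod (\<Sum>i. ?F (i + N)) \<le> (\<Sum>i. cmod (?F (i + N)))"
        by (rule summable_norm) (use summable_ignore_initial_segment[OF sc, of N] in simp)
      also have "\<dots> = e N"
        by (simp add: e_def norm_mult norm_power)
      finally show "?S t \<le> h t + e N"
        using le[of t] t by simp
    qed
  qed
  have "e \<longlonglongrightarrow> 0"
    unfolding e_def using suminf_exist_split2[OF sum] by simp
  hence "(\<lambda>N. I + pi * e N) \<longlonglongrightarrow> I + pi * 0"
    by (intro tendsto_intros)
  hence "pi * u m \<le> I + pi * 0"
    by (rule LIMSEQ_le_const) (use bound in \<open>auto intro!: exI[of _ "Suc m"]\<close>)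
  thus ?thesis by (simp add: field_simps)
qed

lemma sin_half_ge:
  assumes "0 \<le> t" "t \<le> pi"
  shows "t / pi \<le> sin (t / 2)"
proof -
  have "convex_on {0..pi/2} (\<lambda>x. - sin x)"
  proof (rule f''_ge0_imp_convex)
    show "((\<lambda>x. - sin x) has_real_derivative - cos x) (at x)" for x :: real
      by (auto intro!: derivative_eq_intros)
    show "((\<lambda>x. - cos x) has_real_derivative sin x) (at x)" for x :: real
      by (auto intro!: derivative_eq_intros)
    show "0 \<le> sin x" if "x \<in> {0..pi/2}" for x
      using that by (intro sin_ge_zero) auto
  qed auto
  from convex_onD[OF this, of "t / pi" 0 "pi / 2"] assms show ?thesis
    by simp
qed

text \<open>The induction runs on absolute values because \<open>sin (real m * x)\<close> and
  \<open>cos x\<close> may be negative.\<close>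

lemma sin_mult_le:
  assumes "0 \<le> x" "x \<le> pi"
  shows "sin (real m * x) \<le> real m * sin x"
proof -
  have "\<bar>sin (real m * x)\<bar> \<le> real m * \<bar>sin x\<bar>"
  proof (induction m)
    case (Suc m)
    have "\<bar>sin (real (Suc m) * x)\<bar> = \<bar>sin (real m * x) * cos x + cos (real m * x) * sin x\<bar>"
      by (simp add: algebra_simps sin_add)
    also have "\<dots> \<le> \<bar>sin (real m * x)\<bar> * \<bar>cos x\<bar> + \<bar>cos (real m * x)\<bar> * \<bar>sin x\<bar>"
      by (metis abs_mult abs_triangle_ineq)
    also have "\<dots> \<le> (real m * \<bar>sin x\<bar>) * 1 + 1 * \<bar>sin x\<bar>"
      using Suc by (intro add_mono mult_mono) auto
    finally show ?case by (simp add: algebra_simps)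
  qed simp
  thus ?thesis using sin_ge_zero[OF assms] by simp
qed

text \<open>In half angles \<open>k\<close> enters only through one sine, which
  \<open>sin_mult_le\<close> controls for general k and the triple-angle formula makes explicit for
  k = 2.\<close>

lemma norm_run_den_cis:
  assumes "k \<ge> 1"
  shows "(cmod (1 - cis t + of_real a * cis t ^ k))\<^sup>2 =
    a\<^sup>2 + 4 * (sin (t / 2))\<^sup>2 - 4 * a * sin (t / 2) * sin (real (2 * k - 1) * (t / 2))"
proof -
  have s2: "2 - 2 * cos t = 4 * (sin (t / 2))\<^sup>2"
    using cos_double_sin[of "t / 2"] by simp
  \<comment> \<open>The angles k t and (k - 1) t lie symmetrically about (2 k - 1) t / 2, at
    distance t / 2.\<close>
  have cd: "cos (real k * t) - cos (real k * t - t) =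
      - 2 * sin (t / 2) * sin (real (2 * k - 1) * (t / 2))"
  proof -
    have "real k * t = real (2 * k - 1) * (t / 2) + t / 2"
      "real k * t - t = real (2 * k - 1) * (t / 2) - t / 2"
      using assms by (auto simp: of_nat_diff algebra_simps)
    thus ?thesis by (simp only: cos_add cos_diff) simp
  qed
  have "(cmod (1 - cis t + of_real a * cis t ^ k))\<^sup>2 =
      (1 - cos t + a * cos (real k * t))\<^sup>2 + (a * sin (real k * t) - sin t)\<^sup>2"
    by (simp add: cmod_power2 cos_n_Re_cis_pow_n [symmetric] sin_n_Im_cis_pow_n [symmetric])
  also have "\<dots> = 1 - 2 * cos t + ((cos t)\<^sup>2 + (sin t)\<^sup>2) +
      a\<^sup>2 * ((cos (real k * t))\<^sup>2 + (sin (real k * t))\<^sup>2)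
      + 2 * a * (cos (real k * t) - cos (real k * t - t))"
  proof -
    have "(1 - x + a * X)\<^sup>2 + (a * Y - y)\<^sup>2 =
        1 - 2 * x + (x\<^sup>2 + y\<^sup>2) + a\<^sup>2 * (X\<^sup>2 + Y\<^sup>2) + 2 * a * (X - (X * x + Y * y))"
      for x y X Y :: real
      by (simp add: power2_eq_square algebra_simps)
    thus ?thesis unfolding cos_diff .
  qed
  also have "\<dots> = (2 - 2 * cos t) + a\<^sup>2 + 2 * a * (cos (real k * t) - cos (real k * t - t))"
    by simp
  finally show ?thesis
    unfolding s2 cd by (simp add: algebra_simps)
qed

lemma inverse_quadratic_has_integral:
  assumes "c > (0::real)"
  obtains I where "((\<lambda>t. 1 / (1 + (c * t)\<^sup>2)) has_integral I) {0..pi}" "I \<le> pi / (2 * c)"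
proof
  have "((\<lambda>t. arctan (c * t) / c) has_vector_derivative 1 / (1 + (c * t)\<^sup>2)) (at t within {0..pi})" for t
    unfolding has_real_derivative_iff_has_vector_derivative[symmetric]
    using assms by (auto intro!: derivative_eq_intros simp: divide_inverse)
  thus "((\<lambda>t. 1 / (1 + (c * t)\<^sup>2)) has_integral (arctan (c * pi) / c - arctan (c * 0) / c)) {0..pi}"
    by (intro fundamental_theorem_of_calculus) auto
  show "arctan (c * pi) / c - arctan (c * 0) / c \<le> pi / (2 * c)"
    using arctan_ubound[of "c * pi"] assms by (simp add: field_simps)
qed

lemma inverse_quadratic_cubed_has_integral:
  assumes "c > (0::real)"
  obtains I where "((\<lambda>t. 1 / (1 + (c * t)\<^sup>2) ^ 3) has_integral I) {0..pi}" "I \<le> 3 * pi / (16 * c)"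
proof -
  define W :: "real \<Rightarrow> real" where "W x = inverse (1 + x\<^sup>2)" for x
  \<comment> \<open>\<open>G\<close> is an antiderivative of W^3. Its limit at infinity, 3/8 times
    pi/2, bounds the integral for every \<open>c\<close>.\<close>
  define G :: "real \<Rightarrow> real" where
    "G x = x * (W x)\<^sup>2 / 4 + 3 / 8 * x * W x + 3 / 8 * arctan x" for x
  have ne: "1 + x\<^sup>2 > 0" for x :: real by (simp add: add_pos_nonneg)
  have G': "(G has_real_derivative 1 / (1 + x\<^sup>2) ^ 3) (at x within A)" for x A
  proof -
    have W': "(W has_real_derivative - (2 * x * (W x)\<^sup>2)) (at x within A)"
      unfolding W_def using ne[of x]
      by (auto intro!: derivative_eq_intros simp: power2_eq_square)
    have "(G has_real_derivative
        ((W x)\<^sup>2 + x * (2 * W x * (- (2 * x * (W x)\<^sup>2)))) / 4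
        + (3 / 8 * W x + 3 / 8 * x * (- (2 * x * (W x)\<^sup>2))) + 3 / 8 * W x) (at x within A)"
      unfolding G_def
      by (auto intro!: derivative_eq_intros W' simp: W_def [symmetric])
         (simp add: field_simps power2_eq_square)
    moreover have "W x * (1 + x\<^sup>2) = 1"
      using ne[of x] by (simp add: W_def)
    hence "((W x)\<^sup>2 + x * (2 * W x * (- (2 * x * (W x)\<^sup>2)))) / 4
        + (3 / 8 * W x + 3 / 8 * x * (- (2 * x * (W x)\<^sup>2))) + 3 / 8 * W x = (W x) ^ 3"
      by algebra
    ultimately have "(G has_real_derivative (W x) ^ 3) (at x within A)"
      by (simp only:)
    thus ?thesis by (simp add: W_def divide_inverse flip: power_inverse)
  qed
  have mono: "G x \<le> G y" if "x \<le> y" for x y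
    using that by (rule DERIV_nonneg_imp_nondecreasing) (use G' ne in \<open>auto intro!: exI[of _ "1 / (1 + _\<^sup>2) ^ 3"] less_imp_le\<close>)
  have "(G \<longlongrightarrow> 3 * pi / 16) at_top"
    unfolding G_def W_def by real_asymp
  hence lim: "G x \<le> 3 * pi / 16" for x
    by (rule tendsto_lowerbound) (auto intro!: eventually_mono[OF eventually_ge_at_top[of x]] mono)
  show ?thesis
  proof
    have "((\<lambda>t. G (c * t) / c) has_vector_derivative 1 / (1 + (c * t)\<^sup>2) ^ 3) (at t within {0..pi})" for t
      unfolding has_real_derivative_iff_has_vector_derivative[symmetric]
      using assms by (auto intro!: derivative_eq_intros DERIV_chain2[OF G'])
    thus "((\<lambda>t. 1 / (1 + (c * t)\<^sup>2) ^ 3) has_integral (G (c * pi) / c - G (c * 0) / c)) {0..pi}"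
      by (intro fundamental_theorem_of_calculus) auto
    show "G (c * pi) / c - G (c * 0) / c \<le> 3 * pi / (16 * c)"
      using divide_right_mono[OF lim[of "c * pi"], of c] assms by (simp add: G_def)
  qed
qed


text \<open>As 3.24 = 6 * 0.54, the contrary would give sin 0.54 \<le> 1/2, against the Taylor
  bound. The tightest use is k = 2, n = 3, which needs pi below about 3.27.\<close>

lemma pi_less_3_24: "pi < 3.24"
proof (rule ccontr)
  assume "\<not> pi < 3.24"
  hence "sin (0.54 :: real) \<le> sin (pi / 6)"
    by (intro sin_monotone_2pi_le) auto
  hence "sin (0.54 :: real) \<le> 1 / 2"
    by (simp add: sin_30)
  moreover have "\<bar>sin (0.54 :: real) - (\<Sum>m<4. sin_coeff m * 0.54 ^ m)\<bar> \<le> inverse (fact 4) * \<bar>0.54\<bar> ^ 4"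
    by (rule Maclaurin_sin_bound)
  moreover have "(\<Sum>m<4. sin_coeff m * (0.54 :: real) ^ m) = 0.54 - 0.54 ^ 3 / 6"
  proof -
    have "(\<Sum>m<4. f m) = f 0 + f 1 + f 2 + f 3" for f :: "nat \<Rightarrow> real"
      by (simp add: eval_nat_numeral)
    thus ?thesis by (simp add: sin_coeff_def fact_numeral)
  qed
  moreover have "inverse (fact 4) * \<bar>0.54 :: real\<bar> ^ 4 = 0.54 ^ 4 / 24"
    by (simp add: eval_nat_numeral field_simps)
  ultimately show False
    by (simp add: eval_nat_numeral abs_if split: if_splits)
qed

lemma fps_of_real_mult:
  "Abs_fps (\<lambda>m. complex_of_real (fps_nth (f * g) m)) =
     Abs_fps (\<lambda>m. of_real (fps_nth f m)) * Abs_fps (\<lambda>m. of_real (fps_nth g m))"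
  by (rule fps_ext) (simp add: fps_mult_nth)

lemma fps_of_real_power:
  "Abs_fps (\<lambda>m. complex_of_real (fps_nth (f ^ n) m)) = Abs_fps (\<lambda>m. of_real (fps_nth f m)) ^ n"
proof (induction n)
  case 0
  show ?case by (rule fps_ext) simp
next
  case (Suc n)
  thus ?case by (simp add: fps_of_real_mult)
qed

section \<open>Characteristic function and largest point probability of the sum\<close>

context run_seq
begin

text \<open>The complexified series times the denominator is the constant \<open>a\<close>. As
  \<open>a\<close> is nonzero, this also shows that the denominator has no zero on the unit
  circle.\<close>

lemma norm_char_P_power:
  assumes "cmod z = 1"
  shows "cmod (\<Sum>m. of_real (fps_nth (P ^ n) m) * z ^ m) = (a / cmod (1 - z + of_real a * z ^ k)) ^ n"
proof -
  let ?C = "\<lambda>f. Abs_fps (\<lambda>m. complex_of_real (fps_nth f m))"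
  have rad: "fps_conv_radius (?C f) = fps_conv_radius f" for f
    unfolding fps_conv_radius_def
    by (subst (1 2) conv_radius_norm [symmetric]) simp
  have lt: "ereal (norm z) < fps_conv_radius (?C P)"
    using fps_conv_radius_P assms by (simp add: rad one_ereal_def)
  have "?C (run_den k a) = run_den k (of_real a)"
    by (rule fps_ext) (simp add: run_den_def fps_X_power_iff)
  hence "run_den k (of_real a) * ?C P = ?C (fps_const a)"
    using fps_of_real_mult[of "run_den k a" P] by (simp add: run_den_mult_P)
  also have "?C (fps_const a) = fps_const (of_real a)"
    by (rule fps_ext) simp
  finally have "eval_fps (run_den k (of_real a) * ?C P) z = of_real a"
    by simp
  hence "(1 - z + of_real a * z ^ k) * eval_fps (?C P) z = of_real a"
    using lt by (subst (asm) eval_fps_mult) auto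
  hence "cmod (1 - z + of_real a * z ^ k) * cmod (eval_fps (?C P) z) = a"
    using a_pos by (metis norm_mult norm_of_real abs_of_pos)
  hence "cmod (eval_fps (?C P) z) = a / cmod (1 - z + of_real a * z ^ k)"
    using a_pos by (cases "cmod (1 - z + of_real a * z ^ k) = 0") (auto simp: field_simps)
  moreover have "(\<Sum>m. of_real (fps_nth (P ^ n) m) * z ^ m) = eval_fps (?C P) z ^ n"
    using eval_fps_power[OF lt, of n] unfolding fps_of_real_power [symmetric]
    by (simp add: eval_fps_def)
  ultimately show ?thesis by (simp add: norm_power)
qed

lemma P_power_le_fourier:
  assumes h: "(h has_integral I) {0..pi}"
    and le: "\<And>t. 0 \<le> t \<Longrightarrow> t \<le> pi \<Longrightarrow> (a / cmod (1 - cis t + of_real a * cis t ^ k)) ^ n \<le> h t"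
  shows "fps_nth (P ^ n) m \<le> I / pi"
  using P_power_sums[of n] P_power_nonneg
  by (intro coeff_le_fourier_integral[OF _ h]) (auto simp: norm_char_P_power le sums_iff)

lemma P_power_bound_ge_3:
  assumes k3: "k \<ge> 3" and n: "n \<ge> 3"
  shows "(fps_nth (P ^ n) m)\<^sup>2 \<le> 1 / (2 * pi * (real n + 1 / 4))"
proof -
  \<comment> \<open>The factor 22 is 44/2: below, d^2 \<ge> a^2 (1 + 44 s^2), Bernoulli is applied
    with exponent 2 to the squared modulus, and s \<ge> t / pi supplies the division by pi. The root
    then leaves 1 / (1 + (c t)^2).\<close>
  define c where "c = sqrt (22 * real n) / pi"
  have c: "c > 0" "c\<^sup>2 = 22 * real n / pi\<^sup>2"
    using n by (auto simp: c_def power_divide)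
  obtain I where I: "((\<lambda>t. 1 / (1 + (c * t)\<^sup>2)) has_integral I) {0..pi}" "I \<le> pi / (2 * c)"
    by (rule inverse_quadratic_has_integral[OF c(1)])
  have ka: "real k * a \<le> 4 / 9"
    by (rule k_times_a_le[OF k3])
  have "3 * a \<le> real k * a"
    using k3 a_pos by (intro mult_right_mono) auto
  hence a27: "a \<le> 4 / 27" using ka by simp
  have "a * a \<le> 4 / 27 * a"
    using a27 a_pos by (intro mult_right_mono) auto
  moreover have "real (2 * k - 1) * a = 2 * (real k * a) - a"
    using k by (simp add: of_nat_diff algebra_simps)
  \<comment> \<open>Since k a \<le> 4/9 the right side is at least 1/9 + a, and 11 a^2 \<le> (44/27)
    a stays below this for a \<le> 4/27.\<close>
  ultimately have sigma: "11 * a\<^sup>2 \<le> 1 - real (2 * k - 1) * a"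
    using ka a27 a_pos unfolding power2_eq_square by linarith
  have "fps_nth (P ^ n) m \<le> I / pi"
  proof (rule P_power_le_fourier[OF I(1)])
    fix t :: real assume t: "0 \<le> t" "t \<le> pi"
    define s where "s = sin (t / 2)"
    define d where "d = cmod (1 - cis t + of_real a * cis t ^ k)"
    have s: "t / pi \<le> s" "s \<ge> 0"
      using sin_half_ge[OF t] t by (auto simp: s_def intro: sin_ge_zero)
    have "sin (real (2 * k - 1) * (t / 2)) \<le> real (2 * k - 1) * s"
      unfolding s_def using t by (intro sin_mult_le) auto
    hence "4 * a * s * sin (real (2 * k - 1) * (t / 2)) \<le> 4 * a * s * (real (2 * k - 1) * s)"
      using a_pos s by (intro mult_left_mono) auto
    hence "d\<^sup>2 \<ge> a\<^sup>2 + 4 * s\<^sup>2 * (1 - real (2 * k - 1) * a)"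
      using norm_run_den_cis[OF k, of t a] unfolding d_def s_def[symmetric]
      by (simp add: power2_eq_square algebra_simps)
    moreover have "4 * s\<^sup>2 * (1 - real (2 * k - 1) * a) \<ge> 4 * s\<^sup>2 * (11 * a\<^sup>2)"
      using sigma by (intro mult_left_mono) auto
    ultimately have d2: "d\<^sup>2 \<ge> a\<^sup>2 * (1 + 44 * s\<^sup>2)"
      by (simp add: algebra_simps)
    have pos: "1 + 44 * s\<^sup>2 > 0" by (simp add: add_pos_nonneg)
    have dpos: "d\<^sup>2 > 0"
      using d2 pos a_pos by (intro less_le_trans[OF _ d2]) auto
    have "((a / d) ^ n)\<^sup>2 = (a\<^sup>2 / d\<^sup>2) ^ n"
      by (simp add: power_divide power_mult [symmetric] mult.commute)
    also have "\<dots> \<le> (1 / (1 + 44 * s\<^sup>2)) ^ n"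
      using d2 dpos pos by (intro power_mono) (auto simp: field_simps)
    also have "\<dots> = 1 / (1 + 44 * s\<^sup>2) ^ n"
      by (simp add: power_divide)
    also have "\<dots> \<le> 1 / (1 + real n / real 2 * (44 * s\<^sup>2)) ^ 2"
      using n by (intro divide_left_mono power_ge_Bernoulli_power mult_pos_pos zero_less_power)
        (auto intro!: add_pos_nonneg)
    also have "\<dots> \<le> 1 / (1 + (c * t)\<^sup>2) ^ 2"
    proof (intro divide_left_mono power_mono)
      have "(t / pi)\<^sup>2 \<le> s\<^sup>2"
        using s t by (intro power_mono) auto
      hence "22 * real n * (t / pi)\<^sup>2 \<le> 22 * real n * s\<^sup>2"
        by (intro mult_left_mono) auto
      thus "1 + (c * t)\<^sup>2 \<le> 1 + real n / real 2 * (44 * s\<^sup>2)"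
        by (simp add: power_mult_distrib c power_divide)
    qed (auto intro!: mult_pos_pos zero_less_power add_pos_nonneg)
    finally have "((a / d) ^ n)\<^sup>2 \<le> (1 / (1 + (c * t)\<^sup>2))\<^sup>2"
      by (simp add: power_divide)
    thus "(a / cmod (1 - cis t + of_real a * cis t ^ k)) ^ n \<le> 1 / (1 + (c * t)\<^sup>2)"
      unfolding d_def [symmetric] by (rule power2_le_imp_le) simp
  qed
  also have "I / pi \<le> 1 / (2 * c)"
    using I(2) by (simp add: field_simps)
  finally have "(fps_nth (P ^ n) m)\<^sup>2 \<le> (1 / (2 * c))\<^sup>2"
    using P_power_nonneg by (intro power_mono)
  also have "\<dots> = pi\<^sup>2 / (88 * real n)"
    using n by (simp add: power_divide power_mult_distrib c)
  also have "\<dots> \<le> 1 / (2 * pi * (real n + 1 / 4))"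
  proof -
    have "pi ^ 3 \<le> 3.24 ^ 3"
      using pi_less_3_24 by (intro power_mono) auto
    hence "pi ^ 3 * (2 * (real n + 1 / 4)) \<le> 3.24 ^ 3 * (2 * (real n + 1 / 4))"
      by (intro mult_right_mono) auto
    also have "\<dots> \<le> 88 * real n"
      using n by (simp add: eval_nat_numeral)
    finally have "pi\<^sup>2 * (2 * pi * (real n + 1 / 4)) \<le> 88 * real n"
      by (simp add: power2_eq_square power3_eq_cube mult_ac)
    thus ?thesis
      using n by (simp add: divide_le_eq le_divide_eq mult_ac)
  qed
  finally show ?thesis .
qed

lemma P_power_bound_2:
  assumes k2: "k = 2" and n: "n \<ge> 3"
  shows "(fps_nth (P ^ n) m)\<^sup>2 \<le> 1 / (2 * pi * (real n + 1 / 4))"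
proof -
  \<comment> \<open>Here d \<ge> a (1 + 8 s^2) without squares, and Bernoulli has exponent 3, whence
    8 n / 3. Exponent 2 would give pi^2 / (64 n) for the squared probability, which is too large at
    n = 3.\<close>
  define c where "c = sqrt (8 * real n / 3) / pi"
  have c: "c > 0" "c\<^sup>2 = 8 * real n / (3 * pi\<^sup>2)"
    using n by (auto simp: c_def power_divide)
  obtain I where I: "((\<lambda>t. 1 / (1 + (c * t)\<^sup>2) ^ 3) has_integral I) {0..pi}" "I \<le> 3 * pi / (16 * c)"
    by (rule inverse_quadratic_cubed_has_integral[OF c(1)])
  have a4: "a \<le> 1 / 4" using a_le_quarter k2 by simp
  have "fps_nth (P ^ n) m \<le> I / pi"
  proof (rule P_power_le_fourier[OF I(1)])
    fix t :: real assume t: "0 \<le> t" "t \<le> pi"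
    define s where "s = sin (t / 2)"
    define d where "d = cmod (1 - cis t + of_real a * cis t ^ k)"
    have s: "t / pi \<le> s" "s \<ge> 0"
      using sin_half_ge[OF t] t by (auto simp: s_def intro: sin_ge_zero)
    have sin3: "sin (3 * (t / 2)) = 3 * s - 4 * s ^ 3"
    proof -
      have "sin (3 * (t / 2)) = sin (2 * (t / 2)) * cos (t / 2) + cos (2 * (t / 2)) * s"
        unfolding s_def by (simp flip: sin_add)
      also have "\<dots> = 2 * s * (cos (t / 2))\<^sup>2 + (1 - 2 * s\<^sup>2) * s"
        unfolding sin_double cos_double_sin s_def by (simp add: power2_eq_square)
      also have "(cos (t / 2))\<^sup>2 = 1 - s\<^sup>2"
        unfolding s_def by (rule cos_squared_eq)
      finally show ?thesis by (simp add: power2_eq_square power3_eq_cube algebra_simps)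
    qed
    have "d\<^sup>2 = a\<^sup>2 + 4 * s\<^sup>2 - 4 * a * s * (3 * s - 4 * s ^ 3)"
      using norm_run_den_cis[OF k, of t a] unfolding d_def s_def[symmetric]
      by (simp add: k2 sin3 [simplified])
    \<comment> \<open>Both remainder terms carry the factor 1 - 4 a, nonnegative by a \<le> 1/4; at
      a = 1/4 the bound is an equality.\<close>
    also have "\<dots> = (a * (1 + 8 * s\<^sup>2))\<^sup>2 + 4 * s\<^sup>2 * ((1 - 4 * a) * (1 + a)) + 16 * a * s ^ 4 * (1 - 4 * a)"
      by (simp add: power2_eq_square power3_eq_cube power4_eq_xxxx algebra_simps)
    also have "\<dots> \<ge> (a * (1 + 8 * s\<^sup>2))\<^sup>2"
      using a4 a_pos by (simp add: add_nonneg_nonneg)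
    finally have d: "a * (1 + 8 * s\<^sup>2) \<le> d"
      by (rule power2_le_imp_le) (simp add: d_def)
    have pos: "1 + 8 * s\<^sup>2 > 0" by (simp add: add_pos_nonneg)
    have dpos: "d > 0"
      using pos a_pos by (intro less_le_trans[OF _ d]) auto
    have "(a / d) ^ n \<le> (1 / (1 + 8 * s\<^sup>2)) ^ n"
      using d dpos pos a_pos by (intro power_mono) (auto simp: field_simps)
    also have "\<dots> = 1 / (1 + 8 * s\<^sup>2) ^ n"
      by (simp add: power_divide)
    also have "\<dots> \<le> 1 / (1 + real n / real 3 * (8 * s\<^sup>2)) ^ 3"
      using n by (intro divide_left_mono power_ge_Bernoulli_power mult_pos_pos zero_less_power)
        (auto intro!: add_pos_nonneg)
    also have "\<dots> \<le> 1 / (1 + (c * t)\<^sup>2) ^ 3"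
    proof (intro divide_left_mono power_mono)
      have "(t / pi)\<^sup>2 \<le> s\<^sup>2"
        using s t by (intro power_mono) auto
      hence "8 * real n / 3 * (t / pi)\<^sup>2 \<le> 8 * real n / 3 * s\<^sup>2"
        by (intro mult_left_mono) auto
      thus "1 + (c * t)\<^sup>2 \<le> 1 + real n / real 3 * (8 * s\<^sup>2)"
        by (simp add: power_mult_distrib c power_divide)
    qed (auto intro!: mult_pos_pos zero_less_power add_pos_nonneg)
    finally show "(a / cmod (1 - cis t + of_real a * cis t ^ k)) ^ n \<le> 1 / (1 + (c * t)\<^sup>2) ^ 3"
      unfolding d_def .
  qed
  also have "I / pi \<le> 3 / (16 * c)"
    using I(2) by (simp add: field_simps)
  finally have "(fps_nth (P ^ n) m)\<^sup>2 \<le> (3 / (16 * c))\<^sup>2"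
    using P_power_nonneg by (intro power_mono)
  also have "\<dots> = 27 * pi\<^sup>2 / (2048 * real n)"
    using n by (simp add: power_divide power_mult_distrib c)
  also have "\<dots> \<le> 1 / (2 * pi * (real n + 1 / 4))"
  proof -
    have "pi ^ 3 \<le> 3.24 ^ 3"
      using pi_less_3_24 by (intro power_mono) auto
    hence "pi ^ 3 * (54 * (real n + 1 / 4)) \<le> 3.24 ^ 3 * (54 * (real n + 1 / 4))"
      by (intro mult_right_mono) auto
    also have "\<dots> \<le> 2048 * real n"
      using n by (simp add: eval_nat_numeral)
    finally have "27 * pi\<^sup>2 * (2 * pi * (real n + 1 / 4)) \<le> 2048 * real n"
      by (simp add: power2_eq_square power3_eq_cube mult_ac)
    thus ?thesis
      using n by (simp add: divide_le_eq le_divide_eq mult_ac)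
  qed
  finally show ?thesis .
qed

text \<open>The Fourier estimates take n \<ge> 3. For n \<le> 2 the trivial bound a \<le> 1/4
  suffices, because 2 pi (n + 1/4) \<le> 16.\<close>

lemma P_power_bound:
  assumes k2: "k \<ge> 2" and n: "n \<ge> 1"
  shows "(fps_nth (P ^ n) m)\<^sup>2 \<le> 1 / (2 * pi * (real n + 1 / 4))"
proof (cases "n \<ge> 3")
  case True
  thus ?thesis
    using P_power_bound_2 P_power_bound_ge_3 k2 by (cases "k = 2") auto
next
  case False
  have "fps_nth (P ^ n) m \<le> 1 / 4"
    using P_power_le_a[OF n, of m] a_le_quarter[OF k2] by linarith
  hence "(fps_nth (P ^ n) m)\<^sup>2 \<le> (1 / 4)\<^sup>2"
    using P_power_nonneg by (intro power_mono)
  also have "\<dots> \<le> 1 / (2 * pi * (real n + 1 / 4))"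
  proof -
    have "pi * (real n + 1 / 4) \<le> 3.24 * (2 + 1 / 4)"
      using pi_less_3_24 False by (intro mult_mono) auto
    also have "\<dots> \<le> 8" by (simp add: power2_eq_square)
    finally have "2 * pi * (real n + 1 / 4) \<le> 16"
      unfolding mult.assoc by linarith
    hence "1 / 16 \<le> 1 / (2 * pi * (real n + 1 / 4))"
      by (intro divide_left_mono) auto
    thus ?thesis by (simp add: power2_eq_square)
  qed
  finally show ?thesis .
qed

end

section \<open>The Stein identity of the sum\<close>

lemma summable_fps_moments:
  fixes f :: "real fps"
  assumes "fps_conv_radius f > 1"
  shows "summable (\<lambda>m. \<bar>fps_nth f m\<bar>)"
    and "summable (\<lambda>m. real m * \<bar>fps_nth f m\<bar>)"
    and "summable (\<lambda>m. real m ^ 2 * \<bar>fps_nth f m\<bar>)"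
proof -
  have 0: "summable (\<lambda>m. \<bar>fps_nth g m\<bar>)" if "fps_conv_radius g > 1" for g :: "real fps"
    using norm_summable_fps[of 1 g] that by (simp add: one_ereal_def)
  \<comment> \<open>The operator z d/dz multiplies the m-th coefficient by m and keeps the radius of
    convergence above 1.\<close>
  define \<theta> :: "real fps \<Rightarrow> real fps" where "\<theta> g = fps_X * fps_deriv g" for g
  have \<theta>_nth: "fps_nth (\<theta> g) m = real m * fps_nth g m" for g m
    by (cases m) (simp_all add: \<theta>_def)
  have \<theta>_rad: "fps_conv_radius (\<theta> g) > 1" if "fps_conv_radius g > 1" for g
  proof -
    have "fps_conv_radius (fps_deriv g) > 1"
      using that fps_conv_radius_deriv[of g] by (rule less_le_trans)
    thus ?thesis
      unfolding \<theta>_def by (intro less_le_trans[OF _ fps_conv_radius_mult]) simp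
  qed
  show "summable (\<lambda>m. \<bar>fps_nth f m\<bar>)"
    using assms by (rule 0)
  show "summable (\<lambda>m. real m * \<bar>fps_nth f m\<bar>)"
    using 0[OF \<theta>_rad[OF assms]] by (simp add: \<theta>_nth abs_mult)
  show "summable (\<lambda>m. real m ^ 2 * \<bar>fps_nth f m\<bar>)"
    using 0[OF \<theta>_rad[OF \<theta>_rad[OF assms]]]
    by (simp add: \<theta>_nth abs_mult power2_eq_square mult.assoc)
qed

lemma summable_fps_choose_2:
  fixes f :: "real fps"
  assumes "fps_conv_radius f > 1"
  shows "summable (\<lambda>l. real (l * (l - 1)) / 2 * \<bar>fps_nth f l\<bar>)"
proof (rule summable_comparison_test'[OF summable_fps_moments(3)[OF assms], where N = 0])
  fix l :: nat
  have "real (l * (l - 1)) \<le> real (l * l)"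
    unfolding of_nat_le_iff by (intro mult_mono) auto
  moreover have "real (l * l) = real l ^ 2"
    by (simp add: power2_eq_square)
  ultimately have "real (l * (l - 1)) / 2 \<le> real l ^ 2"
    using zero_le_power2[of "real l"] by linarith
  hence "real (l * (l - 1)) / 2 * \<bar>fps_nth f l\<bar> \<le> real l ^ 2 * \<bar>fps_nth f l\<bar>"
    by (rule mult_right_mono) simp
  thus "norm (real (l * (l - 1)) / 2 * \<bar>fps_nth f l\<bar>) \<le> real l ^ 2 * \<bar>fps_nth f l\<bar>"
    by simp
qed

text \<open>Source of the weight l (l - 1) / 2: the integers l - 1, l - 2, ... add up to it once J
  is large.\<close>

lemma sum_diff_Suc_le: "(\<Sum>j<J. real (l - Suc j)) \<le> real (l * (l - 1)) / 2"
proof (induction l arbitrary: J)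
  case (Suc l)
  show ?case
  proof (cases J)
    case (Suc J')
    have "(\<Sum>j<J. real (Suc l - Suc j)) = real l + (\<Sum>j<J'. real (l - Suc j))"
      unfolding Suc by (subst sum.lessThan_Suc_shift) simp
    also have "\<dots> \<le> real l + real (l * (l - 1)) / 2"
      using Suc.IH by simp
    also have "\<dots> = real (Suc l * (Suc l - 1)) / 2"
      by (cases l) (simp_all add: field_simps)
    finally show ?thesis .
  qed simp
qed simp

text \<open>The coefficients of H = E / (1 - z)^2 are iterated partial sums of those of
  \<open>E\<close>. The double zero rewrites them as tail sums, which are absolutely summable and
  add up to the stated weight.\<close>

lemma double_zero_factor:
  fixes E :: "real fps"
  assumes rad: "fps_conv_radius E > 1"
    and E0: "eval_fps E 1 = 0" and E1: "eval_fps (fps_deriv E) 1 = 0"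
  obtains H where "E = (1 - fps_X) * ((1 - fps_X) * H)" "summable (\<lambda>j. \<bar>fps_nth H j\<bar>)"
    "(\<Sum>j. \<bar>fps_nth H j\<bar>) \<le> (\<Sum>l. real (l * (l - 1)) / 2 * \<bar>fps_nth E l\<bar>)"
proof -
  let ?e = "fps_nth E"
  define H where "H = Abs_fps (\<lambda>j. \<Sum>l\<le>j. (real j + 1 - real l) * ?e l)"
  have H1: "fps_nth ((1 - fps_X) * H) j = (\<Sum>l\<le>j. ?e l)" for j
  proof (cases j)
    case 0
    thus ?thesis by (simp add: fps_nth_one_minus_X_mult H_def)
  next
    case (Suc i)
    have "(\<Sum>l\<le>i. (real j + 1 - real l) * ?e l) - (\<Sum>l\<le>i. (real i + 1 - real l) * ?e l) = (\<Sum>l\<le>i. ?e l)"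
      unfolding sum_subtractf[symmetric] Suc by (intro sum.cong) (auto simp: algebra_simps)
    thus ?thesis
      using Suc by (simp add: fps_nth_one_minus_X_mult H_def algebra_simps)
  qed
  have fact1: "E = (1 - fps_X) * ((1 - fps_X) * H)"
  proof (rule fps_ext)
    fix m
    show "?e m = fps_nth ((1 - fps_X) * ((1 - fps_X) * H)) m"
      unfolding fps_nth_one_minus_X_mult[of "(1 - fps_X) * H"] H1 by (cases m) auto
  qed
  have sumE: "?e sums 0"
    using sums_eval_fps[of 1 E] rad E0 by (simp add: one_ereal_def)
  have "(\<lambda>l. fps_nth (fps_deriv E) l * 1 ^ l) sums eval_fps (fps_deriv E) 1"
    using less_le_trans[OF rad fps_conv_radius_deriv] by (intro sums_eval_fps) (simp add: one_ereal_def)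
  hence "(\<lambda>l. real (Suc l) * ?e (Suc l)) sums 0"
    by (simp add: E1)
  hence sumE1: "(\<lambda>l. real l * ?e l) sums 0"
    by (subst (asm) sums_Suc_iff) simp
  have H_sums: "(\<lambda>l. real (l - Suc j) * ?e l) sums fps_nth H j" for j
  proof -
    \<comment> \<open>Since the sums of \<open>?e l\<close> and of \<open>l * ?e l\<close> are both
      0, the full sum of (l - j - 1) \<open>?e l\<close> vanishes, so its part over l > j equals the
      head sum defining \<open>H\<close>.\<close>
    have "(\<lambda>l. real l * ?e l - (real j + 1) * ?e l + (if l \<le> j then (real j + 1 - real l) * ?e l else 0))
        sums (0 - (real j + 1) * 0 + (\<Sum>l | l \<le> j. (real j + 1 - real l) * ?e l))"
      by (intro sums_add sums_diff sums_mult sumE sumE1 sums_If_finite) auto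
    moreover have "real l * ?e l - (real j + 1) * ?e l + (if l \<le> j then (real j + 1 - real l) * ?e l else 0)
        = real (l - Suc j) * ?e l" for l
    proof (cases "l \<le> j")
      case True
      thus ?thesis by (simp add: algebra_simps)
    next
      case False
      hence "real (l - Suc j) = real l - (real j + 1)" by (simp add: of_nat_diff)
      thus ?thesis using False by (simp add: algebra_simps)
    qed
    ultimately show ?thesis
      by (simp add: H_def atMost_def)
  qed
  have sumabs: "summable (\<lambda>l. real (l - Suc j) * \<bar>?e l\<bar>)" for j
    by (rule summable_comparison_test'[OF summable_fps_moments(2)[OF rad], where N = 0])
       (auto intro!: mult_right_mono)
  have H_le: "\<bar>fps_nth H j\<bar> \<le> (\<Sum>l. real (l - Suc j) * \<bar>?e l\<bar>)" for j
    using summable_rabs[of "\<lambda>l. real (l - Suc j) * ?e l"] sumabs[of j] H_sums[of j]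
    by (simp add: sums_iff abs_mult)
  let ?R = "\<Sum>l. real (l * (l - 1)) / 2 * \<bar>?e l\<bar>"
  have partial: "(\<Sum>j<J. \<bar>fps_nth H j\<bar>) \<le> ?R" for J
  proof -
    have "(\<Sum>j<J. \<bar>fps_nth H j\<bar>) \<le> (\<Sum>j<J. \<Sum>l. real (l - Suc j) * \<bar>?e l\<bar>)"
      by (intro sum_mono H_le)
    also have "\<dots> = (\<Sum>l. \<Sum>j<J. real (l - Suc j) * \<bar>?e l\<bar>)"
      by (rule suminf_sum [symmetric]) (rule sumabs)
    also have "\<dots> \<le> ?R"
    proof (rule suminf_le)
      show "(\<Sum>j<J. real (l - Suc j) * \<bar>?e l\<bar>) \<le> real (l * (l - 1)) / 2 * \<bar>?e l\<bar>" for l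
        unfolding sum_distrib_right[symmetric] by (intro mult_right_mono sum_diff_Suc_le) auto
      show "summable (\<lambda>l. \<Sum>j<J. real (l - Suc j) * \<bar>?e l\<bar>)"
        by (intro summable_sum sumabs)
      show "summable (\<lambda>l. real (l * (l - 1)) / 2 * \<bar>?e l\<bar>)"
        by (rule summable_fps_choose_2[OF rad])
    qed
    finally show ?thesis .
  qed
  have summ: "summable (\<lambda>j. \<bar>fps_nth H j\<bar>)"
    by (rule summableI_nonneg_bounded[OF _ partial]) auto
  moreover have "(\<Sum>j. \<bar>fps_nth H j\<bar>) \<le> ?R"
    by (rule suminf_le_const[OF summ partial])
  ultimately show ?thesis
    using that fact1 by blast
qed

lemma suminf_abs_fps_mult_le:
  fixes f g :: "real fps"
  assumes "summable (\<lambda>m. \<bar>fps_nth f m\<bar>)" "summable (\<lambda>m. \<bar>fps_nth g m\<bar>)"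
  shows "summable (\<lambda>m. \<bar>fps_nth (f * g) m\<bar>)"
    and "(\<Sum>m. \<bar>fps_nth (f * g) m\<bar>) \<le> (\<Sum>m. \<bar>fps_nth f m\<bar>) * (\<Sum>m. \<bar>fps_nth g m\<bar>)"
proof -
  let ?c = "\<lambda>m. \<Sum>i\<le>m. \<bar>fps_nth f i\<bar> * \<bar>fps_nth g (m - i)\<bar>"
  have c: "?c sums ((\<Sum>m. \<bar>fps_nth f m\<bar>) * (\<Sum>m. \<bar>fps_nth g m\<bar>))"
    using assms by (intro Cauchy_product_sums) auto
  have le: "\<bar>fps_nth (f * g) m\<bar> \<le> ?c m" for m
    unfolding fps_mult_nth atLeast0AtMost abs_mult[symmetric] by (rule sum_abs)
  show s: "summable (\<lambda>m. \<bar>fps_nth (f * g) m\<bar>)"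
    by (rule summable_comparison_test'[OF sums_summable[OF c], where N = 0]) (use le in auto)
  show "(\<Sum>m. \<bar>fps_nth (f * g) m\<bar>) \<le> (\<Sum>m. \<bar>fps_nth f m\<bar>) * (\<Sum>m. \<bar>fps_nth g m\<bar>)"
    using suminf_le[OF le s sums_summable[OF c]] c by (simp add: sums_iff)
qed

text \<open>With total sum 0 a partial sum is minus a tail, and m times the tail is dominated by the
  tail of the first absolute moment.\<close>

lemma partial_sums_zero_sum_LIMSEQ:
  fixes w :: "nat \<Rightarrow> real"
  assumes w: "w sums 0" and sum: "summable (\<lambda>m. real m * \<bar>w m\<bar>)"
  shows "(\<lambda>m. real m * (\<Sum>i\<le>m. w i)) \<longlonglongrightarrow> 0"
proof -
  let ?t = "\<lambda>m. \<Sum>i. real (i + Suc m) * \<bar>w (i + Suc m)\<bar>"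
  have lim: "?t \<longlonglongrightarrow> 0"
    using LIMSEQ_Suc[OF suminf_exist_split2[OF sum]] by simp
  have bound: "\<bar>real m * (\<Sum>i\<le>m. w i)\<bar> \<le> ?t m" for m
  proof -
    have st: "summable (\<lambda>i. real (i + Suc m) * \<bar>w (i + Suc m)\<bar>)"
      using summable_ignore_initial_segment[OF sum, of "Suc m"] .
    have sm: "summable (\<lambda>i. \<bar>real m * w (i + Suc m)\<bar>)"
      by (rule summable_comparison_test'[OF st, where N = 0])
         (auto simp: abs_mult intro!: mult_right_mono)
    have "(\<Sum>i\<le>m. w i) = - (\<Sum>i. w (i + Suc m))"
      using suminf_split_initial_segment[of w "Suc m"] w
      by (simp add: sums_iff lessThan_Suc_atMost)
    hence "real m * (\<Sum>i\<le>m. w i) = - (\<Sum>i. real m * w (i + Suc m))"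
      using w by (subst suminf_mult) (auto simp: sums_iff summable_ignore_initial_segment
                                             simp del: add_Suc_right)
    hence "\<bar>real m * (\<Sum>i\<le>m. w i)\<bar> \<le> (\<Sum>i. \<bar>real m * w (i + Suc m)\<bar>)"
      using summable_rabs[OF sm] by simp
    also have "\<dots> \<le> ?t m"
      by (rule suminf_le[OF _ sm st]) (auto simp: abs_mult intro!: mult_right_mono)
    finally show ?thesis .
  qed
  show ?thesis
    by (rule Lim_null_comparison[OF always_eventually lim], rule allI, subst real_norm_def, rule bound)
qed

lemma fps_conv_radius_deriv_gt_1:
  fixes f :: "real fps"
  assumes "fps_conv_radius f > 1"
  shows "fps_conv_radius (fps_deriv f) > 1"
  using assms fps_conv_radius_deriv by (rule less_le_trans)

lemma fps_conv_radius_gt_1: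
  fixes f g :: "real fps"
  assumes "fps_conv_radius f > 1" "fps_conv_radius g > 1"
  shows "fps_conv_radius (f * g) > 1" "fps_conv_radius (f - g) > 1" "fps_conv_radius (f + g) > 1"
  using less_le_trans[OF _ fps_conv_radius_mult[of f g], of 1]
    less_le_trans[OF _ fps_conv_radius_diff[of f g], of 1]
    less_le_trans[OF _ fps_conv_radius_add[of f g], of 1] assms
  by auto

lemma eval_fps_at_1:
  fixes f g :: "real fps"
  assumes "fps_conv_radius f > 1" "fps_conv_radius g > 1"
  shows "eval_fps (f * g) 1 = eval_fps f 1 * eval_fps g 1"
    "eval_fps (f - g) 1 = eval_fps f 1 - eval_fps g 1"
    "eval_fps (f + g) 1 = eval_fps f 1 + eval_fps g 1"
  using assms by (simp_all add: eval_fps_mult eval_fps_diff eval_fps_add one_ereal_def)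

section \<open>Stein identity with matched mean and variance\<close>

locale run_approx = run_seq +
  fixes n :: nat and p q \<alpha> :: real
  assumes n: "n \<ge> 1"
    and cond: "1 - 2 * real k * a + real k * a\<^sup>2 > 0"
    and p: "p = (1 - real k * a) * a / (1 - (2 * real k - 1) * a)"
    and \<alpha>: "\<alpha> = real n * (1 - real k * a)\<^sup>2 / (1 - 2 * real k * a + real k * a\<^sup>2)"
    and q: "q = 1 - p"
begin

lemma ka_lt_1: "real k * a < 1"
proof -
  have "real k * a * 1 \<le> real k * a * (2 - a)"
    using a_pos a_lt_1 by (intro mult_left_mono) auto
  also have "\<dots> < 1"
    using cond by (simp add: algebra_simps power2_eq_square)
  finally show ?thesis by simp
qed

text \<open>The gap is exactly the left side of \<open>cond\<close>, which is also the numerator of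
  \<open>q\<close>; it yields p < 1.\<close>

lemma denominator_gt: "1 - (2 * real k - 1) * a > (1 - real k * a) * a"
  using cond by (simp add: algebra_simps power2_eq_square)

lemma denominator_pos: "1 - (2 * real k - 1) * a > 0"
  using ka_lt_1 a_pos by (intro less_trans[OF _ denominator_gt]) simp

sublocale neg_binomial \<alpha> p q
proof
  show "\<alpha> > 0"
    using n cond ka_lt_1 by (simp add: \<alpha>)
  show "0 < p"
    unfolding p using ka_lt_1 a_pos denominator_pos by simp
  show "p < 1"
    unfolding p using denominator_pos denominator_gt by simp
qed (rule q)

definition A :: "real fps" where "A = (1 - fps_const q * fps_X) * B"

text \<open>Minus the derivative of 1 - z + a z^k, so that \<open>num * B\<close> is the logarithmic
  derivative of \<open>P\<close>.\<close>

definition num :: "real fps" where "num = 1 - fps_const (real k * a) * fps_X ^ (k - 1)"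

text \<open>This is q \<alpha> minus (1 - q z) times the logarithmic derivative of
  \<open>P ^ n\<close>.\<close>

definition E :: "real fps" where
  "E = fps_const (q * \<alpha>) - fps_const (real n) * (num * A)"

lemma conv_radius_num: "fps_conv_radius num = \<infinity>"
proof -
  have "num = fps_of_poly (1 - Polynomial.monom (real k * a) (k - 1))"
    by (simp add: num_def fps_of_poly_simps fps_of_poly_monom)
  thus ?thesis by (simp only: fps_conv_radius_fps_of_poly)
qed

lemma conv_radius_A: "fps_conv_radius A > 1"
proof -
  have "1 - fps_const q * fps_X = fps_of_poly [:1, -q:]"
    by (simp add: fps_of_poly_pCons flip: fps_const_neg)
  hence "fps_conv_radius (1 - fps_const q * fps_X) = \<infinity>"
    by (simp only: fps_conv_radius_fps_of_poly)
  thus ?thesis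
    unfolding A_def by (intro less_le_trans[OF _ fps_conv_radius_mult]) (simp add: fps_conv_radius_B)
qed

lemma conv_radius_E: "fps_conv_radius E > 1"
  unfolding E_def
  by (rule less_le_trans[OF _ fps_conv_radius_diff], simp,
      rule less_le_trans[OF _ fps_conv_radius_mult], simp,
      rule less_le_trans[OF _ fps_conv_radius_mult], simp add: conv_radius_num conv_radius_A)

lemma fps_nth_A: "fps_nth A m = b m - (if m = 0 then 0 else q * b (m - 1))"
  by (simp add: A_def run_fps_def algebra_simps)

lemma fps_deriv_P: "fps_deriv P = num * B * P"
proof -
  have "fps_deriv (run_den k a) = - num"
    by (simp add: run_den_def num_def fps_deriv_power mult_ac fps_of_nat flip: fps_const_mult)
  moreover have "fps_deriv (run_den k a * P) = 0"
    by (simp add: run_den_mult_P)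
  ultimately have "run_den k a * fps_deriv P = num * P"
    by (simp add: algebra_simps)
  hence "(run_den k a * B) * fps_deriv P = num * B * P"
    by (simp add: mult_ac)
  thus ?thesis
    using run_den_mult_run_fps[OF k, of a] by simp
qed

lemma fps_deriv_P_power: "fps_deriv (P ^ n) = fps_const (real n) * (num * B) * P ^ n"
proof -
  have "fps_deriv (P ^ n) = fps_const (real n) * fps_deriv P * P ^ (n - 1)"
    by (simp add: fps_deriv_power fps_of_nat mult_ac)
  also have "\<dots> = fps_const (real n) * (num * B) * (P * P ^ (n - 1))"
    by (simp add: fps_deriv_P mult_ac)
  also have "P * P ^ (n - 1) = P ^ n"
    using n by (cases n) auto
  finally show ?thesis .
qed

text \<open>With U = \<open>P ^ n\<close>, the product U E equals q \<alpha> U - (1 - q z) U'; its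
  coefficients are the weights of g(m + 1) in the averaged Stein operator.\<close>

lemma fps_nth_P_power_mult_E:
  "fps_nth (P ^ n * E) m =
     q * (\<alpha> + real m) * fps_nth (P ^ n) m - real (Suc m) * fps_nth (P ^ n) (Suc m)"
proof -
  have "P ^ n * E = fps_const (q * \<alpha>) * P ^ n - fps_deriv (P ^ n) + fps_const q * (fps_X * fps_deriv (P ^ n))"
    unfolding fps_deriv_P_power E_def A_def by (simp add: algebra_simps)
  hence "fps_nth (P ^ n * E) m = q * \<alpha> * fps_nth (P ^ n) m - fps_nth (fps_deriv (P ^ n)) m
      + q * (if m = 0 then 0 else fps_nth (fps_deriv (P ^ n)) (m - 1))"
    by simp
  thus ?thesis
    by (cases m) (simp_all add: algebra_simps)
qed

lemma eval_B_1: "eval_fps B 1 = 1 / a"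
proof -
  have "eval_fps (run_den k a * B) 1 = (1 - 1 + a * 1 ^ k) * eval_fps B 1"
    using fps_conv_radius_B by (subst eval_fps_mult) (auto simp: one_ereal_def)
  thus ?thesis
    using a_pos run_den_mult_run_fps[OF k, of a] by (simp add: field_simps)
qed

lemma eval_num_1: "eval_fps num 1 = 1 - real k * a"
  unfolding num_def by (simp add: eval_fps_at_1 fps_conv_radius_gt_1)

lemma eval_deriv_num_1: "eval_fps (fps_deriv num) 1 = - (real k * a * real (k - 1))"
proof -
  have "fps_deriv num = fps_const (- (real k * a * real (k - 1))) * fps_X ^ (k - 2)"
    by (simp add: num_def fps_deriv_power mult_ac fps_of_nat numeral_2_eq_2
             flip: fps_const_mult fps_const_neg)
  thus ?thesis by (simp add: eval_fps_at_1)
qed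

lemma eval_deriv_B_1: "eval_fps (fps_deriv B) 1 = (1 - real k * a) / a\<^sup>2"
proof -
  have "fps_const a * fps_deriv B = num * B * P"
    using fps_deriv_P by (simp add: P_def)
  hence "eval_fps (fps_const a * fps_deriv B) 1 = eval_fps (num * B * P) 1"
    by simp
  hence "a * eval_fps (fps_deriv B) 1 = (1 - real k * a) * (1 / a)"
    by (simp add: eval_fps_at_1 fps_conv_radius_gt_1 fps_conv_radius_deriv_gt_1 fps_conv_radius_B
          fps_conv_radius_P conv_radius_num eval_num_1 eval_B_1 eval_P_1)
  thus ?thesis using a_pos by (simp add: field_simps power2_eq_square)
qed

lemma eval_A_1: "eval_fps A 1 = p / a"
  unfolding A_def
  by (simp add: eval_fps_at_1 fps_conv_radius_gt_1 fps_conv_radius_B eval_B_1 q)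

lemma eval_deriv_A_1: "eval_fps (fps_deriv A) 1 = p * (1 - real k * a) / a\<^sup>2 - q / a"
proof -
  have "fps_deriv A = (1 - fps_const q * fps_X) * fps_deriv B - fps_const q * B"
    by (simp add: A_def algebra_simps)
  hence "eval_fps (fps_deriv A) 1 = (1 - q) * ((1 - real k * a) / a\<^sup>2) - q * (1 / a)"
    by (simp add: eval_fps_at_1 fps_conv_radius_gt_1 fps_conv_radius_deriv_gt_1 fps_conv_radius_B
          eval_B_1 eval_deriv_B_1)
  also have "1 - q = p" by (simp add: q)
  finally show ?thesis by simp
qed

lemma p_times_denominator: "p * (1 - (2 * real k - 1) * a) = (1 - real k * a) * a"
  using denominator_pos unfolding p by simp

lemma q_times_denominator: "q * (1 - (2 * real k - 1) * a) = 1 - 2 * real k * a + real k * a\<^sup>2"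
  using p_times_denominator unfolding q by (simp add: algebra_simps power2_eq_square)

text \<open>Equality of means: \<alpha> q / p = n (1 - k a) / a.\<close>

lemma eval_E_1: "eval_fps E 1 = 0"
proof -
  let ?d = "1 - (2 * real k - 1) * a"
  have "q * \<alpha> * ?d = (q * ?d) * \<alpha>"
    by simp
  also have "\<dots> = real n * (1 - real k * a)\<^sup>2"
    unfolding q_times_denominator using cond by (simp add: \<alpha>)
  finally have "q * \<alpha> * ?d = real n * (1 - real k * a)\<^sup>2" .
  moreover have "real n * ((1 - real k * a) * (p / a)) * ?d = real n * (1 - real k * a)\<^sup>2"
  proof -
    have "real n * ((1 - real k * a) * (p / a)) * ?d = real n * (1 - real k * a) * ((p * ?d) / a)"
      by (simp add: mult_ac)
    also have "(p * ?d) / a = 1 - real k * a"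
      unfolding p_times_denominator using a_pos by simp
    finally show ?thesis by (simp add: power2_eq_square mult_ac)
  qed
  ultimately have "q * \<alpha> * ?d = real n * ((1 - real k * a) * (p / a)) * ?d"
    by (simp only:)
  hence "q * \<alpha> = real n * ((1 - real k * a) * (p / a))"
    using denominator_pos by (simp only: mult_cancel_right) auto
  thus ?thesis
    unfolding E_def
    by (simp add: eval_fps_at_1 fps_conv_radius_gt_1 conv_radius_A conv_radius_num eval_num_1 eval_A_1)
qed

text \<open>Given equal means, this is equality of variances, the ratio of variance to mean being 1
  / p. Up to the factor -n only \<open>k\<close>, \<open>a\<close> and \<open>p\<close> occur;
  \<open>X\<close> is the derivative of \<open>num * A\<close> at 1, and clearing its denominators
  leaves a polynomial identity.\<close>

lemma eval_deriv_E_1: "eval_fps (fps_deriv E) 1 = 0"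
proof -
  let ?d = "1 - (2 * real k - 1) * a"
  define X where "X = (1 - real k * a) * (p * (1 - real k * a) / a\<^sup>2 - q / a) - real k * a * real (k - 1) * (p / a)"
  have "X * a\<^sup>2 * ?d = (1 - real k * a) * ((p * ?d) * (1 - real k * a) - (q * ?d) * a) - real k * a\<^sup>2 * (real k - 1) * (p * ?d)"
  proof -
    have "X * a\<^sup>2 = (1 - real k * a) * (p * (1 - real k * a) - q * a) - real k * a\<^sup>2 * (real k - 1) * p"
      using a_pos k by (simp add: X_def of_nat_diff power2_eq_square field_simps)
    thus ?thesis by algebra
  qed
  also have "\<dots> = 0"
    unfolding p_times_denominator q_times_denominator by algebra
  finally have "X = 0"
    using a_pos denominator_pos by simp
  moreover have "fps_deriv E = fps_const (- real n) * (num * fps_deriv A + fps_deriv num * A)"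
    by (simp add: E_def flip: fps_const_neg)
  hence "eval_fps (fps_deriv E) 1 = - real n *
      (eval_fps num 1 * eval_fps (fps_deriv A) 1 + eval_fps (fps_deriv num) 1 * eval_fps A 1)"
    by (simp add: eval_fps_at_1 fps_conv_radius_gt_1 fps_conv_radius_deriv_gt_1
          conv_radius_A conv_radius_num)
  hence "eval_fps (fps_deriv E) 1 = - real n * X"
    unfolding eval_num_1 eval_A_1 eval_deriv_A_1 eval_deriv_num_1 X_def by (simp only: mult_minus_left diff_conv_add_uminus)
  ultimately show ?thesis by simp
qed

text \<open>Since U E = (1 - z) V with V = (1 - z) U H, the coefficients of \<open>V\<close> are the
  partial sums required by \<open>dTV_le_stein\<close>. Their norm is at most that of (1 - z) U,
  bounded by \<open>2 * M\<close> through unimodality, times that of \<open>H\<close>.\<close>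

lemma dTV_le_max_prob:
  assumes M: "\<And>m. fps_nth (P ^ n) m \<le> M"
  shows "dTV (fps_nth (P ^ n)) \<pi> \<le> 1 / (\<alpha> * q) * (2 * M * (\<Sum>l. real (l * (l - 1)) / 2 * \<bar>fps_nth E l\<bar>))"
proof -
  let ?U = "P ^ n"
  obtain H where H: "E = (1 - fps_X) * ((1 - fps_X) * H)" "summable (\<lambda>j. \<bar>fps_nth H j\<bar>)"
    "(\<Sum>j. \<bar>fps_nth H j\<bar>) \<le> (\<Sum>l. real (l * (l - 1)) / 2 * \<bar>fps_nth E l\<bar>)"
    by (rule double_zero_factor[OF conv_radius_E eval_E_1 eval_deriv_E_1])
  define V where "V = (1 - fps_X) * ?U * H"
  have UE: "?U * E = (1 - fps_X) * V"
    by (simp add: H(1) V_def mult_ac)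
  have V_nth: "fps_nth V m = (\<Sum>i\<le>m. fps_nth (?U * E) i)" for m
    unfolding UE using sum_fps_nth_one_minus_X_mult[of V m] by (simp add: lessThan_Suc_atMost)
  have radUE: "fps_conv_radius (?U * E) > 1"
    by (intro fps_conv_radius_gt_1 fps_conv_radius_P_power conv_radius_E)
  have bound: "(\<Sum>m<N. \<bar>fps_nth ((1 - fps_X) * ?U) m\<bar>) \<le> 2 * M" for N
    by (intro sum_abs_one_minus_X_mult_le sign_change_P_power n P_power_nonneg M)
  have summ: "summable (\<lambda>m. \<bar>fps_nth ((1 - fps_X) * ?U) m\<bar>)"
    by (rule summableI_nonneg_bounded[OF _ bound]) auto
  have M0: "M \<ge> 0" using M[of 0] P_power_nonneg[of n 0] by linarith
  have "dTV (fps_nth ?U) \<pi> \<le> 1 / (\<alpha> * q) * (\<Sum>m. \<bar>fps_nth V m\<bar>)"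
  proof (rule dTV_le_stein)
    show "fps_nth ?U sums 1" by (rule P_power_sums)
    have "(\<lambda>m. \<bar>real m ^ 2 * fps_nth ?U m\<bar>) \<longlonglongrightarrow> 0"
      using summable_LIMSEQ_zero[OF summable_fps_moments(3)[OF fps_conv_radius_P_power[of n]]]
      by (simp add: abs_mult)
    thus "(\<lambda>m. real m ^ 2 * fps_nth ?U m) \<longlonglongrightarrow> 0"
      by (simp only: tendsto_rabs_zero_iff)
    show "fps_nth V m = (\<Sum>i\<le>m. q * (\<alpha> + real i) * fps_nth ?U i - real (Suc i) * fps_nth ?U (Suc i))" for m
      unfolding V_nth fps_nth_P_power_mult_E ..
    have "eval_fps (?U * E) 1 = 0"
      by (simp add: eval_fps_at_1 fps_conv_radius_P_power conv_radius_E eval_E_1)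
    hence "fps_nth (?U * E) sums 0"
      using sums_eval_fps[of 1 "?U * E"] radUE by (simp add: one_ereal_def)
    thus "(\<lambda>m. real m * fps_nth V m) \<longlonglongrightarrow> 0"
      unfolding V_nth by (rule partial_sums_zero_sum_LIMSEQ) (rule summable_fps_moments(2)[OF radUE])
    show "summable (\<lambda>m. \<bar>fps_nth V m\<bar>)"
      unfolding V_def by (rule suminf_abs_fps_mult_le(1)[OF summ H(2)])
  qed (rule P_power_nonneg)
  also have "\<dots> \<le> 1 / (\<alpha> * q) * (2 * M * (\<Sum>l. real (l * (l - 1)) / 2 * \<bar>fps_nth E l\<bar>))"
  proof (rule mult_left_mono)
    have "(\<Sum>m. \<bar>fps_nth V m\<bar>) \<le> (\<Sum>m. \<bar>fps_nth ((1 - fps_X) * ?U) m\<bar>) * (\<Sum>j. \<bar>fps_nth H j\<bar>)"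
      unfolding V_def by (rule suminf_abs_fps_mult_le(2)[OF summ H(2)])
    also have "\<dots> \<le> 2 * M * (\<Sum>l. real (l * (l - 1)) / 2 * \<bar>fps_nth E l\<bar>)"
      using suminf_le_const[OF summ bound] H(2,3) M0
      by (intro mult_mono) (auto intro: suminf_nonneg)
    finally show "(\<Sum>m. \<bar>fps_nth V m\<bar>) \<le> \<dots>" .
    show "1 / (\<alpha> * q) \<ge> 0" using \<alpha>_pos q_pos by simp
  qed
  finally show ?thesis .
qed

text \<open>The first series is shifted by 1 and the second by \<open>k\<close>, so that both start
  at 0 and involve the same differences.\<close>

definition bracket :: real where
  "bracket = (\<Sum>l. real ((l + 1) * l) / 2 * \<bar>b (l + 1) - q * b l\<bar>)
     + real (k * (k - 1) * (k - 2)) / 2 * a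
     + real k * a * (\<Sum>l. real ((l + k) * (l + k - 1)) / 2 * \<bar>b (l + 1) - q * b l\<bar>)"

text \<open>The constant of \<open>E\<close> sits at index 0, where the weight vanishes. The rest is
  -n (A - k a z^(k-1) A), and the triangle inequality separates the two copies of
  \<open>A\<close>.\<close>

lemma weighted_E_le: "(\<Sum>l. real (l * (l - 1)) / 2 * \<bar>fps_nth E l\<bar>) \<le> real n * bracket"
proof -
  define G where "G = fps_X ^ (k - 1) * A"
  define w where "w l = real (l * (l - 1)) / 2" for l
  have w_nonneg: "w l \<ge> 0" for l by (simp add: w_def)
  have G_nth: "fps_nth G l = (if l < k - 1 then 0 else fps_nth A (l - (k - 1)))" for l
    by (simp add: G_def fps_X_power_mult_nth)
  have radG: "fps_conv_radius G > 1"
    unfolding G_def by (intro fps_conv_radius_gt_1 conv_radius_A) simp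
  have sA: "summable (\<lambda>l. w l * \<bar>fps_nth A l\<bar>)"
    unfolding w_def by (rule summable_fps_choose_2[OF conv_radius_A])
  have sG: "summable (\<lambda>l. w l * \<bar>fps_nth G l\<bar>)"
    unfolding w_def by (rule summable_fps_choose_2[OF radG])
  have E_alt: "E = fps_const (q * \<alpha>) - fps_const (real n) * (A - fps_const (real k * a) * G)"
    by (simp add: E_def num_def G_def algebra_simps)
  have le: "w l * \<bar>fps_nth E l\<bar> \<le> real n * (w l * \<bar>fps_nth A l\<bar> + real k * a * (w l * \<bar>fps_nth G l\<bar>))" for l
  proof (cases "l = 0")
    case True
    thus ?thesis by (simp add: w_def)
  next
    case False
    have "\<bar>fps_nth E l\<bar> = real n * \<bar>fps_nth A l - real k * a * fps_nth G l\<bar>"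
      using False by (simp add: E_alt abs_mult)
    also have "\<dots> \<le> real n * (\<bar>fps_nth A l\<bar> + real k * a * \<bar>fps_nth G l\<bar>)"
      using abs_triangle_ineq4[of "fps_nth A l" "real k * a * fps_nth G l"] a_pos
      by (intro mult_left_mono) (auto simp: abs_mult)
    finally have "w l * \<bar>fps_nth E l\<bar> \<le> w l * (real n * (\<bar>fps_nth A l\<bar> + real k * a * \<bar>fps_nth G l\<bar>))"
      by (rule mult_left_mono[OF _ w_nonneg])
    thus ?thesis by (simp add: algebra_simps)
  qed
  have "(\<Sum>l. w l * \<bar>fps_nth E l\<bar>) \<le> (\<Sum>l. real n * (w l * \<bar>fps_nth A l\<bar> + real k * a * (w l * \<bar>fps_nth G l\<bar>)))"
    by (intro suminf_le le summable_mult summable_add sA sG)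
       (use summable_fps_choose_2[OF conv_radius_E] in \<open>simp add: w_def\<close>)
  also have "\<dots> = real n * ((\<Sum>l. w l * \<bar>fps_nth A l\<bar>) + real k * a * (\<Sum>l. w l * \<bar>fps_nth G l\<bar>))"
    by (simp add: suminf_mult suminf_add[symmetric] summable_mult summable_add sA sG)
  also have "(\<Sum>l. w l * \<bar>fps_nth A l\<bar>) = (\<Sum>l. real ((l + 1) * l) / 2 * \<bar>b (l + 1) - q * b l\<bar>)"
    using suminf_split_head[OF sA] by (simp add: w_def fps_nth_A)
  also have "(\<Sum>l. w l * \<bar>fps_nth G l\<bar>) =
      (\<Sum>l. w (l + k) * \<bar>fps_nth G (l + k)\<bar>) + (\<Sum>l<k. w l * \<bar>fps_nth G l\<bar>)"
    by (rule suminf_split_initial_segment[OF sG])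
  \<comment> \<open>Only index k - 1 survives, carrying the leading coefficient A(0) = 1; times k a
    it gives the isolated middle term of the bracket.\<close>
  also have "(\<Sum>l<k. w l * \<bar>fps_nth G l\<bar>) = w (k - 1)"
  proof -
    have "(\<Sum>l<Suc (k - 1). w l * \<bar>fps_nth G l\<bar>) = w (k - 1)"
      by (simp add: G_nth fps_nth_A)
    thus ?thesis using k by simp
  qed
  also have "(\<lambda>l. w (l + k) * \<bar>fps_nth G (l + k)\<bar>) =
      (\<lambda>l. real ((l + k) * (l + k - 1)) / 2 * \<bar>b (l + 1) - q * b l\<bar>)"
    using k by (intro ext) (auto simp: w_def G_nth fps_nth_A)
  finally have "(\<Sum>l. w l * \<bar>fps_nth E l\<bar>) \<le> real n *
      ((\<Sum>l. real ((l + 1) * l) / 2 * \<bar>b (l + 1) - q * b l\<bar>) + real k * a *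
      ((\<Sum>l. real ((l + k) * (l + k - 1)) / 2 * \<bar>b (l + 1) - q * b l\<bar>) + w (k - 1)))" .
  also have "real k * a * w (k - 1) = real (k * (k - 1) * (k - 2)) / 2 * a"
    by (simp add: w_def numeral_2_eq_2)
  hence "real n *
      ((\<Sum>l. real ((l + 1) * l) / 2 * \<bar>b (l + 1) - q * b l\<bar>) + real k * a *
      ((\<Sum>l. real ((l + k) * (l + k - 1)) / 2 * \<bar>b (l + 1) - q * b l\<bar>) + w (k - 1))) =
      real n * bracket"
    unfolding bracket_def distrib_left[of "real k * a"] by (simp only: add_ac)
  finally show ?thesis
    unfolding w_def .
qed

lemma bracket_nonneg: "bracket \<ge> 0"
proof -
  have "(\<Sum>l. real (l * (l - 1)) / 2 * \<bar>fps_nth E l\<bar>) \<ge> 0"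
    by (intro suminf_nonneg summable_fps_choose_2 conv_radius_E) auto
  hence "0 \<le> real n * bracket"
    using weighted_E_le by linarith
  thus ?thesis using n by (simp add: zero_le_mult_iff)
qed

text \<open>For k = 1 the waiting time is geometric with p = a, and b(l) = q^l makes every
  difference vanish.\<close>

lemma bracket_eq_0: "k = 1 \<Longrightarrow> bracket = 0"
proof -
  assume k1: "k = 1"
  have "p = a" using a_lt_1 by (simp add: p k1)
  hence "b (l + 1) - q * b l = 0" for l
    by (simp add: q bcoef_Suc k1 algebra_simps)
  moreover have "real (k * (k - 1) * (k - 2)) = 0"
    using k1 by simp
  ultimately show ?thesis
    unfolding bracket_def by simp
qed

lemma dTV_le_bracket:
  "dTV (fps_nth (P ^ n)) \<pi> \<le> real n / (\<alpha> * q) * sqrt (2 / pi)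
     * (1/4 + real n * (1 - a / 2 * (1 + a))) powr (-(1/2)) * bracket"
proof -
  define X where "X = sqrt (2 / pi) * (1/4 + real n * (1 - a / 2 * (1 + a))) powr (-(1/2))"
  \<comment> \<open>For k = 1 any bound on the probabilities will do, because the bracket is 0
    there.\<close>
  define M where "M = (if k = 1 then a else sqrt (1 / (2 * pi * (real n + 1 / 4))))"
  have M: "fps_nth (P ^ n) m \<le> M" for m
  proof (cases "k = 1")
    case True
    thus ?thesis using P_power_le_a[OF n] by (simp add: M_def)
  next
    case False
    thus ?thesis
      using P_power_bound[OF _ n, of m] k by (simp add: M_def real_le_rsqrt)
  qed
  have le: "2 * M * bracket \<le> X * bracket"
  proof (cases "k = 1")
    case True
    show ?thesis unfolding bracket_eq_0[OF True] by simp
  next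
    case False
    define Y where "Y = 1/4 + real n * (1 - a / 2 * (1 + a))"
    \<comment> \<open>The correction lies between 0 and 1, so \<open>Y\<close> is positive and at
      most n + 1/4; the factor with \<open>Y\<close> is therefore no smaller than the one obtained
      from the Fourier bound.\<close>
    have "a / 2 * (1 + a) \<le> 1 / 2 * 2" "a / 2 * (1 + a) \<ge> 0"
      using a_pos a_lt_1 by (intro mult_mono, auto)
    hence Y: "Y > 0" "Y \<le> real n + 1 / 4"
      using n by (auto simp: Y_def intro!: add_pos_nonneg mult_left_le)
    have quad: "2\<^sup>2 * (1 / (2 * pi * y)) = 2 / pi * (1 / y)" for y :: real
      by (simp add: power2_eq_square)
    have "2 * M = sqrt (2\<^sup>2) * sqrt (1 / (2 * pi * (real n + 1 / 4)))"
      using False by (simp add: M_def)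
    also have "\<dots> = sqrt (2\<^sup>2 * (1 / (2 * pi * (real n + 1 / 4))))"
      by (rule real_sqrt_mult [symmetric])
    also have "\<dots> = sqrt (2 / pi) * sqrt (1 / (real n + 1 / 4))"
      unfolding quad by (rule real_sqrt_mult)
    also have "\<dots> \<le> sqrt (2 / pi) * sqrt (1 / Y)"
      using Y by (intro mult_left_mono real_sqrt_le_mono divide_left_mono) auto
    also have "sqrt (1 / Y) = Y powr (-(1/2))"
      using Y by (simp add: powr_minus powr_half_sqrt real_sqrt_divide inverse_eq_divide)
    finally have "2 * M \<le> X"
      by (simp add: X_def Y_def)
    thus ?thesis by (rule mult_right_mono) (rule bracket_nonneg)
  qed
  have M0: "M \<ge> 0" using M[of 0] P_power_nonneg[of n 0] by linarith
  have "dTV (fps_nth (P ^ n)) \<pi> \<le> 1 / (\<alpha> * q) * (2 * M * (real n * bracket))"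
    using \<alpha>_pos q_pos M0
    by (intro order_trans[OF dTV_le_max_prob[OF M]] mult_left_mono weighted_E_le) auto
  also have "\<dots> = real n / (\<alpha> * q) * (2 * M * bracket)"
    by simp
  also have "\<dots> \<le> real n / (\<alpha> * q) * (X * bracket)"
    using le \<alpha>_pos q_pos by (intro mult_left_mono) auto
  finally show ?thesis by (simp add: X_def mult.assoc)
qed

end

section \<open>Assembling the bound from the data of the run problem\<close>

lemma run_a_less_1:
  assumes "(k1, k2) \<noteq> (0, 0)" "0 < pb" "pb < 1"
  shows "run_a k1 k2 pb < 1"
proof -
  have lt: "x ^ j < 1" if "0 < x" "x < 1" "j \<noteq> 0" for x :: real and j
    using that by (simp add: power_less_one_iff)
  have le: "x ^ j \<le> 1" if "0 < x" "x < 1" for x :: real and j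
    using that by (simp add: power_le_one)
  show ?thesis
  proof (cases "k1 = 0")
    case True
    thus ?thesis using lt[of pb k2] assms by (simp add: run_a_def)
  next
    case False
    have "(1 - pb) ^ k1 * pb ^ k2 \<le> (1 - pb) ^ k1 * 1"
      using assms le[of pb k2] by (intro mult_left_mono) auto
    moreover have "(1 - pb) ^ k1 < 1"
      using lt[of "1 - pb" k1] False assms by simp
    ultimately show ?thesis unfolding run_a_def by linarith
  qed
qed

theorem theorem4p2:
  fixes k1 k2 n :: nat and pb :: real and D :: "nat pmf"
  assumes k_ne: "(k1, k2) \<noteq> (0, 0)"
    and pb: "0 < pb" "pb < 1"
    and n: "n \<ge> 1"
    and pgf: "\<And>z::real. \<bar>z\<bar> < 1 \<Longrightarrow>
      (\<Sum>m. pmf D m * z ^ m) = run_a k1 k2 pb / (1 - z + run_a k1 k2 pb * z ^ (k1 + k2))"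
    and cond: "1 - 2 * real (k1 + k2) * run_a k1 k2 pb + real (k1 + k2) * (run_a k1 k2 pb)\<^sup>2 > 0"
  shows
    "let k = k1 + k2; a = run_a k1 k2 pb; b = bcoef k a;
         p = (1 - real k * a) * a / (1 - (2 * real k - 1) * a);
         \<alpha> = real n * (1 - real k * a)\<^sup>2 / (1 - 2 * real k * a + real k * a\<^sup>2);
         q = 1 - p
     in dTV (\<lambda>m. pmf (iid_sum_pmf n D) m) (nb_prob \<alpha> p)
        \<le> real n / (\<alpha> * q) * sqrt (2 / pi)
           * (1/4 + real n * (1 - a / 2 * (1 + a))) powr (-(1/2))
           * ((\<Sum>l. real ((l + 1) * l) / 2 * \<bar>b (l + 1) - q * b l\<bar>)
              + real (k * (k - 1) * (k - 2)) / 2 * a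
              + real k * a * (\<Sum>l. real ((l + k) * (l + k - 1)) / 2
                                   * \<bar>b (l + 1) - q * b l\<bar>))"
proof -
  define k where "k = k1 + k2"
  define a where "a = run_a k1 k2 pb"
  define p where "p = (1 - real k * a) * a / (1 - (2 * real k - 1) * a)"
  define \<alpha> where "\<alpha> = real n * (1 - real k * a)\<^sup>2 / (1 - 2 * real k * a + real k * a\<^sup>2)"
  have k: "k \<ge> 1" using k_ne by (auto simp: k_def)
  have a: "0 < a" "a < 1"
    using pb run_a_less_1[OF k_ne pb] by (auto simp: a_def run_a_def)
  have P: "Abs_fps (pmf D) = fps_const a * run_fps k a"
    using pgf by (intro fps_pmf_eq_run_fps k a) (simp add: a_def k_def)
  \<comment> \<open>Nonnegativity is inherited from the point probabilities of
    \<open>D\<close>.\<close>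
  have b_nonneg: "0 \<le> bcoef k a m" for m
  proof -
    have "pmf D m = a * bcoef k a m"
      using arg_cong[OF P, of "\<lambda>f. fps_nth f m"] by (simp add: run_fps_def)
    thus ?thesis using a pmf_nonneg[of D m] by (simp add: zero_le_mult_iff)
  qed
  interpret run_approx k a n p "1 - p" \<alpha>
    using k a b_nonneg n cond by unfold_locales (auto simp: p_def \<alpha>_def k_def a_def)
  have "Abs_fps (pmf (iid_sum_pmf n D)) = P ^ n"
    unfolding fps_pmf_iid_sum P P_def ..
  hence "pmf (iid_sum_pmf n D) = fps_nth (P ^ n)"
    by (simp add: fun_eq_iff flip: \<open>_ = P ^ n\<close>)
  thus ?thesis
    using dTV_le_bracket unfolding bracket_def
    by (simp only: Let_def k_def [symmetric] a_def [symmetric] p_def [symmetric] \<alpha>_def [symmetric])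
qed

end
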